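(* Let $Y=XA+E$, where $X$ is the $m\times p$ matrix of predictors, $A$ is the unknown $p\times n$ coefficient matrix, and $E$ is an $m\times n$ random matrix with independent $N(0,\sigma^2)$ entries. Let $\widehat B$ be the single-stage joint rank and row selection estimator, i.e. a minimizer of $\|Y-XB\|_F^2+\operatorname{pen}(B)$ over all $p\times n$ matrices $B$, where $\operatorname{pen}$ is the penalty defined in the context with constant $c=12$. Then $$\mathbb E\big[\|XA-X\widehat B\|_F^2\big]\le 10\,\|XA-XB\|_F^2+8\operatorname{pen}(B)+768\,n\,\sigma^2\exp(-n/2)$$ for any $p\times n$ matrix $B$ with $r(B)\ge 1$. In particular, if $r(A)\ge 1$, $$\mathbb E\big[\|XA-X\widehat B\|_F^2\big]\lesssim \sigma^2\, r(A)\Big\{n+|J(A)|\log\Big(\frac{p}{|J(A)|}\Big)\Big\},$$ where $\lesssim$ means that the inequality holds up to multiplicative numerical constants.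
   Context: $\|M\|_F^2$ is the squared Frobenius norm of a matrix $M$, i.e. the sum of its squared entries. For a $p\times n$ matrix $B$, $r(B)$ denotes its rank, $J(B)\subseteq\{1,\dots,p\}$ the set of indices of its nonzero rows, and $|J(B)|$ the cardinality of this set. The penalty is $$\operatorname{pen}(B)=c\,\sigma^2\, r(B)\Big\{2n+\log(2e)\,|J(B)|+|J(B)|\log\Big(\frac{ep}{|J(B)|}\Big)\Big\},$$ so that $\operatorname{pen}(B)=0$ for the zero matrix $B$, which has rank $0$.
   Formalization: The printed rate fails when |J(A)|=p exceeds n (X=I, n=1, large equal entries of A); it is proved with log(ep/|J(A)|) in general, and with log(p/|J(A)|) when |J(A)|≤n, or when |J(A)|≤δp for a fixed δ<1 with constant depending on δ. *)

theory Defs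
  imports "HOL-Probability.Probability" "Jordan_Normal_Form.DL_Rank"
begin

definition frob_sq :: "real mat \<Rightarrow> real" where
  "frob_sq M = (\<Sum>i<dim_row M. \<Sum>j<dim_col M. (M $$ (i, j))\<^sup>2)"

text \<open>Library matrices are indexed from 0, so rows are numbered by \<open>0, \<dots>, p - 1\<close>.\<close>

definition nonzero_rows :: "real mat \<Rightarrow> nat set" where
  "nonzero_rows B = {i. i < dim_row B \<and> row B i \<noteq> 0\<^sub>v (dim_col B)}"

text \<open>The parameter of \<^const>\<open>vec_space.rank\<close> is the dimension of the ambient space of the columns.\<close>

definition mat_rank :: "real mat \<Rightarrow> nat" where
  "mat_rank B = vec_space.rank (dim_row B) B"

text \<open>For \<open>B = 0\<close> the quotient inside the logarithm is a division by zero, but then the rank and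
  the number of nonzero rows both vanish, so the penalty is \<open>0\<close>.\<close>

definition jrrs_pen :: "real \<Rightarrow> real \<Rightarrow> real mat \<Rightarrow> real" where
  "jrrs_pen c \<sigma> B =
    (let p = real (dim_row B); n = real (dim_col B); k = real (card (nonzero_rows B))
     in c * \<sigma>\<^sup>2 * real (mat_rank B) *
          (2 * n + ln (2 * exp 1) * k + k * ln (exp 1 * p / k)))"

definition is_jrrs_estimate :: "real \<Rightarrow> real \<Rightarrow> real mat \<Rightarrow> real mat \<Rightarrow> real mat \<Rightarrow> bool" where
  "is_jrrs_estimate c \<sigma> X Y Bhat \<longleftrightarrow>
    is_arg_min (\<lambda>B. frob_sq (Y - X * B) + jrrs_pen c \<sigma> B)
      (\<lambda>B. B \<in> carrier_mat (dim_col X) (dim_col Y)) Bhat"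

definition gaussian_noise ::
    "'w measure \<Rightarrow> nat \<Rightarrow> nat \<Rightarrow> real \<Rightarrow> ('w \<Rightarrow> real mat) \<Rightarrow> bool" where
  "gaussian_noise M m n \<sigma> E \<longleftrightarrow>
    (\<forall>\<omega>\<in>space M. E \<omega> \<in> carrier_mat m n) \<and>
    prob_space.indep_vars M (\<lambda>_. borel) (\<lambda>ij \<omega>. E \<omega> $$ ij) ({..<m} \<times> {..<n}) \<and>
    (\<forall>i<m. \<forall>j<n. distributed M lborel (\<lambda>\<omega>. E \<omega> $$ (i, j)) (normal_density 0 \<sigma>))"

text \<open>The estimator is a random matrix (its entries are measurable) which for every outcome is some
  minimizer of the criterion for the response \<open>Y = X A + E\<close>; ties may be broken arbitrarily.\<close>

definition jrrs_setting ::
    "'w measure \<Rightarrow> nat \<Rightarrow> nat \<Rightarrow> nat \<Rightarrow> real \<Rightarrow> real mat \<Rightarrow> real mat \<Rightarrow>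
      ('w \<Rightarrow> real mat) \<Rightarrow> ('w \<Rightarrow> real mat) \<Rightarrow> ('w \<Rightarrow> real mat) \<Rightarrow> bool" where
  "jrrs_setting M m p n \<sigma> X A E Y Bhat \<longleftrightarrow>
    prob_space M \<and> 0 < \<sigma> \<and>
    X \<in> carrier_mat m p \<and> A \<in> carrier_mat p n \<and>
    gaussian_noise M m n \<sigma> E \<and>
    (\<forall>\<omega>\<in>space M. Y \<omega> = X * A + E \<omega>) \<and>
    (\<forall>i<p. \<forall>j<n. (\<lambda>\<omega>. Bhat \<omega> $$ (i, j)) \<in> borel_measurable M) \<and>
    (\<forall>\<omega>\<in>space M. is_jrrs_estimate 12 \<sigma> X (Y \<omega>) (Bhat \<omega>))"

definition prediction_risk ::
    "'w measure \<Rightarrow> real mat \<Rightarrow> real mat \<Rightarrow> ('w \<Rightarrow> real mat) \<Rightarrow> real" where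
  "prediction_risk M X A Bhat = (\<integral>\<omega>. frob_sq (X * A - X * Bhat \<omega>) \<partial>M)"

end

theory Submission imports Defs begin

text \<open>
  Let \<open>D = X Bhat - X B\<close>. Comparing the criterion at \<open>Bhat\<close> and at \<open>B\<close> bounds
  \<open>\<parallel>X A - X Bhat\<parallel>\<^sup>2 + pen Bhat\<close> by \<open>\<parallel>X A - X B\<parallel>\<^sup>2 + pen B + 2 \<langle>E, D\<rangle>\<close>, so the task is to bound \<open>2 \<langle>E, D\<rangle>\<close> by
  \<open>\<parallel>D\<parallel>\<^sup>2 / 2 + pen Bhat\<close> plus a remainder of small expectation, uniformly over the random rank and support of
  \<open>Bhat\<close>.

  Write \<open>r\<close> and \<open>J\<close> for the rank and the support of \<open>B\<close>, and \<open>k\<close> and \<open>Jh\<close> for those of \<open>Bhat\<close>. The matrix \<open>D\<close> splits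
  orthogonally into a block in a fixed space of dimension at most \<open>r \<bar>J\<bar>\<close>, spanned by the rows of \<open>X B\<close> and the
  columns of \<open>X\<close> in \<open>J\<close>, and two blocks of rank at most \<open>k\<close> that do not involve \<open>B\<close>: one with rows in the row
  space of \<open>X B\<close>, of dimension at most \<open>r\<close>, and one with rows in its orthogonal complement. Both have their
  columns in spaces of dimension at most \<open>\<bar>Jh\<bar>\<close> (\<open>low_rank_perturbation_bound\<close>). The fixed block contributes
  \<open>O(\<sigma>\<^sup>2 r \<bar>J\<bar>)\<close> in expectation. The other two contribute \<open>k\<close> times the sum of the squared operator norms of the
  corresponding blocks of the noise.

  These operator norms are controlled without Gaussian concentration inequalities. The squared operator norm of a
  matrix is at most \<open>4/3\<close> times its largest value on a net of at most \<open>15 ^ dim\<close> normalized integer points, since a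
  top singular vector, suitably scaled and rounded, stays within an angle of squared cosine at least \<open>3/4\<close>
  (\<open>operator_norm_net\<close>). The two row spaces have total dimension at most \<open>n\<close>, so the nets cost \<open>15 ^ n\<close>, and at each
  pair of net points the relevant quantity is a sum of at most \<open>2 \<bar>Jh\<bar>\<close> squared Gaussian coordinates, whose
  exponential moment is bounded in \<open>nn_integral_exp_sum_squares\<close>. The union bound over net points and supports is
  paid for by the three terms of the penalty (\<open>sum_over_supports_le\<close>), with constant \<open>12\<close>. The expected remainder
  is \<open>O(\<sigma>\<^sup>2 (n + r \<bar>J\<bar>))\<close>, which \<open>pen B\<close> dominates as soon as \<open>r \<ge> 1\<close> (\<open>jrrs_pen_lower\<close>); the exponentially small
  term in the theorem is then pure slack.

  The rate bounds are the case \<open>B = A\<close>, in which the bias vanishes, together with an elementary comparison of the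
  penalty with the rate. Without the factor \<open>e\<close> in the logarithm that comparison needs \<open>\<bar>J\<bar>\<close> to be controlled by
  \<open>n\<close>, or \<open>p / \<bar>J\<bar>\<close> to be bounded away from \<open>1\<close>.
\<close>

section \<open>Inner products and orthonormal families\<close>

text \<open>Vectors are real functions on an arbitrary index type of which only the values on a finite set
  \<open>S\<close> matter, so that the dimension \<open>card S\<close> may vary inside a statement. Matrices are treated in
  the same way, with index set \<open>S \<times> T\<close>; then \<open>ip\<close> is the Frobenius inner product. The form is only
  positive semidefinite on functions, which is harmless because values off \<open>S\<close> never enter.\<close>

definition ip :: "'i set \<Rightarrow> ('i \<Rightarrow> real) \<Rightarrow> ('i \<Rightarrow> real) \<Rightarrow> real" where
  "ip S x y = (\<Sum>s\<in>S. x s * y s)"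

text \<open>Orthonormality of the family \<open>(e i)\<close>, \<open>i \<in> I\<close>, for the inner product on \<open>S\<close>.\<close>

definition onf :: "'i set \<Rightarrow> 'k set \<Rightarrow> ('k \<Rightarrow> 'i \<Rightarrow> real) \<Rightarrow> bool" where
  "onf S I e \<longleftrightarrow> (\<forall>i\<in>I. \<forall>j\<in>I. ip S (e i) (e j) = (if i = j then 1 else 0))"

text \<open>Membership in the linear span of \<open>(e i)\<close>, \<open>i \<in> I\<close>, as an identity on \<open>S\<close>; the sum is meaningful
  for finite \<open>I\<close>.\<close>

definition in_span :: "'i set \<Rightarrow> 'k set \<Rightarrow> ('k \<Rightarrow> 'i \<Rightarrow> real) \<Rightarrow> ('i \<Rightarrow> real) \<Rightarrow> bool" where
  "in_span S I e x \<longleftrightarrow> (\<exists>a. \<forall>s\<in>S. x s = (\<Sum>i\<in>I. a i * e i s))"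

lemma ip_commute: "ip S x y = ip S y x"
  unfolding ip_def by (simp add: mult.commute)

lemma ip_cong: "(\<And>s. s \<in> S \<Longrightarrow> x s = x' s) \<Longrightarrow> (\<And>s. s \<in> S \<Longrightarrow> y s = y' s) \<Longrightarrow> ip S x y = ip S x' y'"
  unfolding ip_def by (rule sum.cong) auto

lemma ip_nonneg [simp]: "0 \<le> ip S x x"
  unfolding ip_def by (simp add: sum_nonneg)

lemma ip_self_eq: "ip S x x = (\<Sum>s\<in>S. (x s)\<^sup>2)"
  unfolding ip_def by (simp add: power2_eq_square)

lemma ip_eq_0D: "finite S \<Longrightarrow> ip S x x = 0 \<Longrightarrow> s \<in> S \<Longrightarrow> x s = 0"
  unfolding ip_self_eq by (simp add: sum_nonneg_eq_0_iff)

lemma ip_add_left: "ip S (\<lambda>s. x s + y s) z = ip S x z + ip S y z"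
  unfolding ip_def by (simp add: distrib_right sum.distrib)

lemma ip_diff_left: "ip S (\<lambda>s. x s - y s) z = ip S x z - ip S y z"
  unfolding ip_def by (simp add: left_diff_distrib sum_subtractf)

lemma ip_scale_left: "ip S (\<lambda>s. c * x s) z = c * ip S x z"
  unfolding ip_def by (simp add: sum_distrib_left mult.assoc)

lemma ip_add_right: "ip S z (\<lambda>s. x s + y s) = ip S z x + ip S z y"
  unfolding ip_commute[of S z] by (rule ip_add_left)

lemma ip_diff_right: "ip S z (\<lambda>s. x s - y s) = ip S z x - ip S z y"
  unfolding ip_commute[of S z] by (rule ip_diff_left)

lemma ip_scale_right: "ip S z (\<lambda>s. c * x s) = c * ip S z x"
  unfolding ip_commute[of S z] by (rule ip_scale_left)

lemma ip_sum_left: "ip S (\<lambda>s. \<Sum>i\<in>I. a i * e i s) y = (\<Sum>i\<in>I. a i * ip S (e i) y)"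
  unfolding ip_def sum_distrib_right sum_distrib_left
  by (subst sum.swap) (simp add: mult.assoc)

lemma ip_sum_right: "ip S y (\<lambda>s. \<Sum>i\<in>I. a i * e i s) = (\<Sum>i\<in>I. a i * ip S y (e i))"
  unfolding ip_commute[of S y] by (rule ip_sum_left)

lemma ip_cauchy_schwarz: "(ip S x y)\<^sup>2 \<le> ip S x x * ip S y y"
  using Cauchy_Schwarz_ineq_sum[of x y S] by (simp add: ip_def power2_eq_square)

lemma onfD: "onf S I e \<Longrightarrow> i \<in> I \<Longrightarrow> j \<in> I \<Longrightarrow> ip S (e i) (e j) = (if i = j then 1 else 0)"
  unfolding onf_def by blast

lemma ip_lincomb_onf:
  assumes "onf S I e" "finite I" "j \<in> I"
  shows "ip S (\<lambda>s. \<Sum>i\<in>I. a i * e i s) (e j) = a j"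
proof -
  have "ip S (\<lambda>s. \<Sum>i\<in>I. a i * e i s) (e j) = (\<Sum>i\<in>I. a i * (if i = j then 1 else 0))"
    unfolding ip_sum_left using assms by (intro sum.cong) (auto simp: onfD)
  also have "\<dots> = a j" using assms by (simp add: sum.delta if_distrib cong: if_cong)
  finally show ?thesis .
qed

lemma in_span_coord:
  assumes "onf S I e" "finite I" "in_span S I e x" "s \<in> S"
  shows "x s = (\<Sum>i\<in>I. ip S x (e i) * e i s)"
proof -
  from assms(3) obtain a where a: "\<forall>s\<in>S. x s = (\<Sum>i\<in>I. a i * e i s)" unfolding in_span_def by blast
  have "ip S x (e j) = a j" if "j \<in> I" for j
  proof -
    have "ip S x (e j) = ip S (\<lambda>s. \<Sum>i\<in>I. a i * e i s) (e j)" by (rule ip_cong) (use a in auto)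
    then show ?thesis using ip_lincomb_onf[OF assms(1,2) that] by simp
  qed
  then show ?thesis using a assms(4) by simp
qed

lemma parseval:
  assumes "onf S I e" "finite I" "in_span S I e x"
  shows "ip S y x = (\<Sum>i\<in>I. ip S y (e i) * ip S x (e i))"
proof -
  have "ip S y x = ip S y (\<lambda>s. \<Sum>i\<in>I. ip S x (e i) * e i s)"
    by (rule ip_cong) (use in_span_coord[OF assms] in auto)
  then show ?thesis unfolding ip_sum_right by (simp add: mult.commute)
qed

lemma in_span_orthogonal:
  assumes "onf S K e" "I \<subseteq> K" "finite I" "in_span S I e x" "j \<in> K - I"
  shows "ip S x (e j) = 0"
proof -
  from assms(4) obtain a where a: "\<forall>s\<in>S. x s = (\<Sum>i\<in>I. a i * e i s)" unfolding in_span_def by blast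
  have "ip S x (e j) = ip S (\<lambda>s. \<Sum>i\<in>I. a i * e i s) (e j)" by (rule ip_cong) (use a in auto)
  also have "\<dots> = (\<Sum>i\<in>I. a i * ip S (e i) (e j))" by (rule ip_sum_left)
  also have "\<dots> = 0"
  proof (rule sum.neutral, rule)
    fix i assume "i \<in> I"
    then have "ip S (e i) (e j) = 0" using onfD[OF assms(1), of i j] assms(2,5) by auto
    then show "a i * ip S (e i) (e j) = 0" by simp
  qed
  finally show ?thesis .
qed

lemma in_span_cong:
  "in_span S I e x \<Longrightarrow> (\<And>s. s \<in> S \<Longrightarrow> x s = y s) \<Longrightarrow> (\<And>i s. i \<in> I \<Longrightarrow> e i s = e' i s) \<Longrightarrow> in_span S I e' y"
  unfolding in_span_def by fastforce

lemma in_span_mono: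
  assumes "in_span S I e x" "I \<subseteq> K" "finite K"
  shows "in_span S K e x"
proof -
  from assms(1) obtain a where a: "\<forall>s\<in>S. x s = (\<Sum>i\<in>I. a i * e i s)" unfolding in_span_def by blast
  have "(\<Sum>i\<in>I. a i * e i s) = (\<Sum>i\<in>K. (if i \<in> I then a i else 0) * e i s)" for s
  proof -
    have "(\<Sum>i\<in>K. (if i \<in> I then a i else 0) * e i s) = (\<Sum>i\<in>K. if i \<in> I then a i * e i s else 0)"
      by (intro sum.cong) auto
    also have "\<dots> = (\<Sum>i\<in>K \<inter> I. a i * e i s)" using assms(3) by (simp add: sum.inter_restrict)
    also have "K \<inter> I = I" using assms(2) by blast
    finally show ?thesis by simp
  qed
  with a show ?thesis unfolding in_span_def
    by (intro exI[of _ "\<lambda>i. if i \<in> I then a i else 0"]) auto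
qed

lemma in_span_sum:
  assumes "\<And>l. l \<in> L \<Longrightarrow> in_span S I e (c l)"
  shows "in_span S I e (\<lambda>s. \<Sum>l\<in>L. g l * c l s)"
proof -
  have "\<forall>l\<in>L. \<exists>a. \<forall>s\<in>S. c l s = (\<Sum>i\<in>I. a i * e i s)"
    using assms unfolding in_span_def by blast
  then obtain a where a: "\<And>l s. l \<in> L \<Longrightarrow> s \<in> S \<Longrightarrow> c l s = (\<Sum>i\<in>I. a l i * e i s)" by metis
  have "(\<Sum>l\<in>L. g l * c l s) = (\<Sum>i\<in>I. (\<Sum>l\<in>L. g l * a l i) * e i s)" if "s \<in> S" for s
  proof -
    have "(\<Sum>l\<in>L. g l * c l s) = (\<Sum>l\<in>L. \<Sum>i\<in>I. g l * (a l i * e i s))"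
      using a that by (simp add: sum_distrib_left)
    also have "\<dots> = (\<Sum>i\<in>I. (\<Sum>l\<in>L. g l * a l i) * e i s)"
      by (subst sum.swap) (simp add: sum_distrib_right mult.assoc)
    finally show ?thesis .
  qed
  then show ?thesis unfolding in_span_def by (intro exI[of _ "\<lambda>i. \<Sum>l\<in>L. g l * a l i"]) auto
qed

lemma in_span_diff:
  assumes "in_span S I e x" "in_span S I e y"
  shows "in_span S I e (\<lambda>s. x s - y s)"
proof -
  have "in_span S I e (\<lambda>s. \<Sum>b\<in>(UNIV::bool set). (if b then 1 else - 1) * (if b then x else y) s)"
    by (rule in_span_sum) (use assms in auto)
  then show ?thesis by (simp add: UNIV_bool)
qed

text \<open>Gram-Schmidt in extension form: the new vectors \<open>e' d, \<dots>, e' (d' - 1)\<close> are orthogonal to the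
  old ones, which stay in place, and there are at most as many as elements of \<open>A\<close>.\<close>

lemma gram_schmidt_extend:
  assumes S: "finite S" and "finite A" and e: "onf S {..<d::nat} e"
  shows "\<exists>e' d'. d \<le> d' \<and> d' \<le> d + card A \<and> (\<forall>i<d. e' i = e i) \<and> onf S {..<d'} e' \<and>
           (\<forall>c\<in>A. in_span S {..<d'} e' c)"
  using \<open>finite A\<close>
proof (induction A rule: finite_induct)
  case empty
  then show ?case using e by (intro exI[of _ e] exI[of _ d]) auto
next
  case (insert c A)
  then obtain e' d' where d': "d \<le> d'" "d' \<le> d + card A" and ee: "\<forall>i<d. e' i = e i"
    and on: "onf S {..<d'} e'" and sp: "\<forall>c\<in>A. in_span S {..<d'} e' c" by blast
  define r where "r = (\<lambda>s. c s - (\<Sum>i<d'. ip S c (e' i) * e' i s))"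
  have rorth: "ip S r (e' j) = 0" if "j < d'" for j
    unfolding r_def ip_diff_left using ip_lincomb_onf[OF on _ , of j] that by simp
  show ?case
  proof (cases "ip S r r = 0")
    case True
    then have "\<And>s. s \<in> S \<Longrightarrow> r s = 0" using ip_eq_0D[OF S] by blast
    then have "in_span S {..<d'} e' c" unfolding in_span_def r_def
      by (intro exI[of _ "\<lambda>i. ip S c (e' i)"]) auto
    with sp d' ee on insert.hyps show ?thesis by (intro exI[of _ e'] exI[of _ d']) auto
  next
    case False
    define N where "N = ip S r r"
    have N: "N > 0" using False ip_nonneg[of S r] unfolding N_def by linarith
    define e'' where "e'' = e'(d' := (\<lambda>s. (1 / sqrt N) * r s))"
    have [simp]: "e'' i = e' i" if "i < d'" for i using that by (simp add: e''_def)
    have last: "e'' d' = (\<lambda>s. (1 / sqrt N) * r s)" by (simp add: e''_def)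
    have rorth': "ip S (e'' j) (e'' d') = 0" if "j < d'" for j
      using rorth[OF that] that by (simp add: last ip_scale_right[of S _ "1 / sqrt N" r, simplified] ip_commute[of S "e' j" r])
    have nn: "ip S (e'' d') (e'' d') = 1"
      unfolding last ip_scale_right ip_scale_left N_def[symmetric] using N
      by (simp add: field_simps)
    have on': "onf S {..<Suc d'} e''" unfolding onf_def
    proof (intro ballI)
      fix i j assume "i \<in> {..<Suc d'}" "j \<in> {..<Suc d'}"
      then consider "i < d'" "j < d'" | "i < d'" "j = d'" | "i = d'" "j < d'" | "i = d'" "j = d'"
        by fastforce
      then show "ip S (e'' i) (e'' j) = (if i = j then 1 else 0)"
        using rorth' nn on[THEN onfD, of i j] by cases (auto simp: ip_commute[of S "e'' d'" "e' j"])
    qed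
    have sp1: "in_span S {..<Suc d'} e'' x" if "in_span S {..<d'} e' x" for x
      by (rule in_span_mono[of _ "{..<d'}"]) (auto intro: in_span_cong[OF that])
    have "in_span S {..<Suc d'} e'' c" unfolding in_span_def
    proof (intro exI ballI)
      fix s assume "s \<in> S"
      show "c s = (\<Sum>i<Suc d'. (if i < d' then ip S c (e' i) else sqrt N) * e'' i s)"
        using N by (simp add: last r_def)
    qed
    with sp sp1 d' ee on' insert.hyps show ?thesis
      by (intro exI[of _ e''] exI[of _ "Suc d'"]) auto
  qed
qed

lemma bessel:
  assumes "onf S I e" "finite I"
  shows "(\<Sum>i\<in>I. (ip S x (e i))\<^sup>2) \<le> ip S x x"
proof -
  let ?p = "\<lambda>s. \<Sum>i\<in>I. ip S x (e i) * e i s"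
  have xp: "ip S x ?p = (\<Sum>i\<in>I. (ip S x (e i))\<^sup>2)"
    by (simp add: ip_sum_right power2_eq_square)
  have pp: "ip S ?p ?p = (\<Sum>i\<in>I. (ip S x (e i))\<^sup>2)"
  proof -
    have "ip S ?p ?p = (\<Sum>i\<in>I. ip S x (e i) * ip S ?p (e i))" by (rule ip_sum_right)
    also have "\<dots> = (\<Sum>i\<in>I. ip S x (e i) * ip S x (e i))"
      using ip_lincomb_onf[OF assms] by (intro sum.cong) auto
    finally show ?thesis by (simp add: power2_eq_square)
  qed
  have "0 \<le> ip S (\<lambda>s. x s - ?p s) (\<lambda>s. x s - ?p s)" by (rule ip_nonneg)
  also have "\<dots> = ip S x x - 2 * ip S x ?p + ip S ?p ?p"
    by (simp only: ip_diff_left ip_diff_right ip_commute[of S ?p x])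
  finally show ?thesis unfolding xp pp by simp
qed

lemma ip_delta: "finite S \<Longrightarrow> t \<in> S \<Longrightarrow> ip S (\<lambda>s. if s = t then 1 else 0) x = x t"
  unfolding ip_def by (simp add: if_distrib[of "\<lambda>c. c * _"] sum.delta cong: if_cong)

lemma onf_card_le:
  assumes S: "finite S" and e: "onf S I e" and I: "finite I"
  shows "card I \<le> card S"
proof -
  have "real (card I) = (\<Sum>i\<in>I. ip S (e i) (e i))" using onfD[OF e] by simp
  also have "\<dots> = (\<Sum>t\<in>S. \<Sum>i\<in>I. (e i t)\<^sup>2)" unfolding ip_self_eq by (rule sum.swap)
  also have "\<dots> \<le> (\<Sum>t\<in>S. 1)"
  proof (rule sum_mono)
    fix t assume t: "t \<in> S"
    have "(\<Sum>i\<in>I. (e i t)\<^sup>2) = (\<Sum>i\<in>I. (ip S (\<lambda>s. if s = t then 1 else 0) (e i))\<^sup>2)"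
      using ip_delta[OF S t] by simp
    also have "\<dots> \<le> 1" using bessel[OF e I, of "\<lambda>s. if s = t then 1 else 0"] ip_delta[OF S t, of "\<lambda>s. if s = t then 1 else 0"] by simp
    finally show "(\<Sum>i\<in>I. (e i t)\<^sup>2) \<le> 1" .
  qed
  finally show ?thesis by simp
qed

lemma onb_extend:
  assumes S: "finite S" and e: "onf S {..<d::nat} e"
  shows "\<exists>e' d'. d \<le> d' \<and> d' \<le> card S \<and> (\<forall>i<d. e' i = e i) \<and> onf S {..<d'} e' \<and>
           (\<forall>x. in_span S {..<d'} e' x)"
proof -
  let ?A = "(\<lambda>t s. if s = t then 1 else 0 :: real) ` S"
  obtain e' d' where h: "d \<le> d'" "\<forall>i<d. e' i = e i" "onf S {..<d'} e'"
    "\<forall>c\<in>?A. in_span S {..<d'} e' c"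
    using gram_schmidt_extend[OF S finite_imageI[OF S] e, of "\<lambda>t s. if s = t then 1 else 0 :: real"] by blast
  have "in_span S {..<d'} e' x" for x
  proof -
    have "in_span S {..<d'} e' (\<lambda>s. \<Sum>t\<in>S. x t * (if s = t then 1 else 0))"
      by (rule in_span_sum) (use h(4) in auto)
    then show ?thesis by (rule in_span_cong) (use S in \<open>auto simp: if_distrib sum.delta cong: if_cong\<close>)
  qed
  moreover have "d' \<le> card S" using onf_card_le[OF S h(3)] by simp
  ultimately show ?thesis using h by blast
qed

text \<open>The duality between rank and operator norm. If \<open>h\<close> has rank at most \<open>k\<close> and the quadratic form of
  \<open>g\<close> is bounded by \<open>s\<close> on unit vectors, then \<open>\<langle>g, h\<rangle>\<^sup>2 \<le> k s \<parallel>h\<parallel>\<^sup>2\<close>, stated here after splitting the product with a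
  weight \<open>t\<close>. In an orthonormal basis of the row space of \<open>h\<close> only \<open>k\<close> directions contribute.\<close>

lemma low_rank_young:
  fixes g h :: "'a \<Rightarrow> 'b \<Rightarrow> real"
  assumes "finite I" "finite K" "0 < t"
    and h: "\<And>i j. i \<in> I \<Longrightarrow> j \<in> K \<Longrightarrow> h i j = (\<Sum>l<k. \<alpha> l i * \<beta> l j)"
    and g: "\<And>v. (\<Sum>i\<in>I. (ip K (g i) v)\<^sup>2) \<le> s * ip K v v"
    and s: "0 \<le> s"
  shows "2 * (\<Sum>i\<in>I. ip K (g i) (h i)) \<le> (\<Sum>i\<in>I. ip K (h i) (h i)) / t + t * (real k * s)"
proof -
  have "onf K {..<0::nat} (\<lambda>_ _. 0)" by (simp add: onf_def)
  from gram_schmidt_extend[OF \<open>finite K\<close> _ this, of "\<beta> ` {..<k}"]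
  obtain u k' where k': "k' \<le> card (\<beta> ` {..<k})" and u: "onf K {..<k'} u"
    and sp: "\<And>l. l < k \<Longrightarrow> in_span K {..<k'} u (\<beta> l)" by auto
  have kk: "k' \<le> k" using k' card_image_le[of "{..<k}" \<beta>] by simp
  have hsp: "in_span K {..<k'} u (h i)" if "i \<in> I" for i
    by (rule in_span_cong[OF in_span_sum[of "{..<k}" K "{..<k'}" u \<beta> "\<lambda>l. \<alpha> l i"]])
      (use sp h that in auto)
  have "2 * (\<Sum>i\<in>I. ip K (g i) (h i)) = (\<Sum>i\<in>I. \<Sum>c<k'. 2 * (ip K (g i) (u c) * ip K (h i) (u c)))"
    using parseval[OF u _ hsp] by (simp add: sum_distrib_left)
  also have "\<dots> \<le> (\<Sum>i\<in>I. \<Sum>c<k'. (ip K (h i) (u c))\<^sup>2 / t + t * (ip K (g i) (u c))\<^sup>2)"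
  proof (intro sum_mono)
    fix i c
    have "0 \<le> (ip K (h i) (u c) - t * ip K (g i) (u c))\<^sup>2 / t" using \<open>0 < t\<close> by simp
    also have "\<dots> = (ip K (h i) (u c))\<^sup>2 / t + t * (ip K (g i) (u c))\<^sup>2 - 2 * (ip K (g i) (u c) * ip K (h i) (u c))"
      using \<open>0 < t\<close> by (simp add: field_simps power2_eq_square)
    finally show "2 * (ip K (g i) (u c) * ip K (h i) (u c)) \<le> (ip K (h i) (u c))\<^sup>2 / t + t * (ip K (g i) (u c))\<^sup>2"
      by simp
  qed
  also have "\<dots> = (\<Sum>i\<in>I. \<Sum>c<k'. (ip K (h i) (u c))\<^sup>2) / t + t * (\<Sum>c<k'. \<Sum>i\<in>I. (ip K (g i) (u c))\<^sup>2)"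
    by (simp add: sum.distrib sum_distrib_left sum_divide_distrib sum.swap[of _ "{..<k'}" I])
  also have "(\<Sum>i\<in>I. \<Sum>c<k'. (ip K (h i) (u c))\<^sup>2) = (\<Sum>i\<in>I. ip K (h i) (h i))"
    using parseval[OF u _ hsp] by (intro sum.cong) (auto simp: power2_eq_square)
  also have "(\<Sum>c<k'. \<Sum>i\<in>I. (ip K (g i) (u c))\<^sup>2) \<le> (\<Sum>c<k'. s)"
  proof (rule sum_mono)
    fix c assume c: "c \<in> {..<k'}"
    have "(\<Sum>i\<in>I. (ip K (g i) (u c))\<^sup>2) \<le> s * ip K (u c) (u c)" by (rule g)
    then show "(\<Sum>i\<in>I. (ip K (g i) (u c))\<^sup>2) \<le> s" using onfD[OF u c c] by simp
  qed
  also have "(\<Sum>c<k'. s) \<le> real k * s" using kk s by (simp add: mult_right_mono)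
  finally show ?thesis using \<open>0 < t\<close> by (simp add: mult_left_mono)
qed

section \<open>A net for the operator norm\<close>

text \<open>The unit sphere is compact: with the coordinates off \<open>K\<close> set to zero it is a closed subset of a product of
  compact intervals and points.\<close>

lemma unit_maximizer:
  fixes g :: "'a \<Rightarrow> 'b \<Rightarrow> real"
  assumes I: "finite I" and K: "finite K" "K \<noteq> {}"
  shows "\<exists>v. ip K v v = 1 \<and> (\<forall>x. (\<Sum>i\<in>I. (ip K (g i) x)\<^sup>2) \<le> (\<Sum>i\<in>I. (ip K (g i) v)\<^sup>2) * ip K x x)"
proof -
  define q where "q = (\<lambda>x. \<Sum>i\<in>I. (ip K (g i) x)\<^sup>2)"
  define C where "C = PiE UNIV (\<lambda>s. if s \<in> K then {-1..1::real} else {0}) \<inter> {v. ip K v v = 1}"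
  have cont_ip: "continuous_on UNIV (\<lambda>v. ip K v v)" "continuous_on UNIV (\<lambda>v. ip K (g i) v)" for i
    unfolding ip_def by (intro continuous_intros continuous_on_product_coordinates)+
  have "compact (PiE UNIV (\<lambda>s. if s \<in> K then {-1..1::real} else {0}))"
    unfolding compactin_euclidean_iff[symmetric] euclidean_product_topology[symmetric] compactin_PiE
    by auto
  moreover have "closed {v. ip K v v = (1::real)}"
    using cont_ip(1) by (intro closed_Collect_eq) auto
  ultimately have "compact C" unfolding C_def by (rule compact_Int_closed)
  have norm_in: "\<exists>y\<in>C. \<forall>s\<in>K. y s = x s / sqrt (ip K x x)" if "ip K x x > 0" for x
  proof -
    define y where "y = (\<lambda>s. if s \<in> K then x s / sqrt (ip K x x) else 0)"
    have 1: "ip K y y = 1"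
    proof -
      have "ip K y y = ip K (\<lambda>s. (1 / sqrt (ip K x x)) * x s) (\<lambda>s. (1 / sqrt (ip K x x)) * x s)"
        by (rule ip_cong) (auto simp: y_def)
      also have "\<dots> = 1" unfolding ip_scale_left ip_scale_right using that by (simp add: field_simps)
      finally show ?thesis .
    qed
    have "\<bar>y s\<bar> \<le> 1" if "s \<in> K" for s
    proof -
      have "(y s)\<^sup>2 \<le> ip K y y" unfolding ip_self_eq
        using K(1) that by (intro member_le_sum) auto
      then show ?thesis using 1 by (simp add: abs_square_le_1)
    qed
    then have "\<And>s. s \<in> K \<Longrightarrow> y s \<in> {-1..1}" by (simp add: abs_le_iff)
    moreover have "\<And>s. s \<notin> K \<Longrightarrow> y s = 0" by (simp add: y_def)
    ultimately have "y \<in> C" unfolding C_def using 1 by (auto simp: PiE_iff)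
    then show ?thesis by (intro bexI[of _ y]) (auto simp: y_def)
  qed
  obtain s0 where s0: "s0 \<in> K" using K by blast
  have "ip K (\<lambda>s. if s = s0 then 1 else 0) (\<lambda>s. if s = s0 then 1 else 0) > 0"
    using ip_delta[OF K(1) s0, of "\<lambda>s. if s = s0 then 1 else 0"] by simp
  then have "C \<noteq> {}" using norm_in by blast
  moreover have "continuous_on C q" unfolding q_def
    by (intro continuous_intros continuous_on_subset[OF cont_ip(2)]) auto
  ultimately obtain v where v: "v \<in> C" "\<forall>y\<in>C. q y \<le> q v"
    using continuous_attains_sup[OF \<open>compact C\<close>] by blast
  have "q x \<le> q v * ip K x x" for x
  proof (cases "ip K x x = 0")
    case True
    then have "ip K (g i) x = 0" for i using ip_eq_0D[OF K(1) True] by (simp add: ip_def)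
    then show ?thesis using True by (simp add: q_def)
  next
    case False
    then have p: "ip K x x > 0" using ip_nonneg[of K x] by linarith
    obtain y where y: "y \<in> C" "\<forall>s\<in>K. y s = x s / sqrt (ip K x x)" using norm_in[OF p] by blast
    have "q y = q x / ip K x x"
    proof -
      have "ip K (g i) y = ip K (g i) (\<lambda>s. (1 / sqrt (ip K x x)) * x s)" for i
        by (rule ip_cong) (use y in auto)
      then show ?thesis unfolding q_def ip_scale_right using p
        by (simp add: power_mult_distrib sum_distrib_left power_divide sum_divide_distrib)
    qed
    then have "q x = q y * ip K x x" using p by simp
    then show ?thesis using v(2) y(1) p by (simp add: mult_right_mono)
  qed
  then show ?thesis using v(1) unfolding q_def C_def by blast
qed

text \<open>A maximizer \<open>v\<close> of the quadratic form on the unit sphere is an eigenvector of the form. By the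
  Cauchy-Schwarz inequality the form at any \<open>z\<close> is then at least the maximum times the squared inner
  product with \<open>v\<close>. No triangle inequality is lost, which is what makes a very coarse net sufficient.\<close>

lemma top_singular_direction:
  fixes g :: "'a \<Rightarrow> 'b \<Rightarrow> real"
  assumes I: "finite I" and K: "finite K" "K \<noteq> {}"
  shows "\<exists>v \<mu>. ip K v v = 1 \<and> 0 \<le> \<mu> \<and> (\<forall>x. (\<Sum>i\<in>I. (ip K (g i) x)\<^sup>2) \<le> \<mu> * ip K x x) \<and>
           (\<forall>z. \<mu> * (ip K z v)\<^sup>2 \<le> (\<Sum>i\<in>I. (ip K (g i) z)\<^sup>2))"
proof -
  define q where "q = (\<lambda>x. \<Sum>i\<in>I. (ip K (g i) x)\<^sup>2)"
  obtain v where v: "ip K v v = 1" "\<And>x. q x \<le> q v * ip K x x"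
    using unit_maximizer[OF I K, of g] unfolding q_def by blast
  define B where "B = (\<lambda>z. \<Sum>i\<in>I. ip K (g i) v * ip K (g i) z)"
  have eigen: "B z = q v * ip K v z" for z
  proof -
    define c where "c = B z - q v * ip K v z"
    define D where "D = q v * ip K z z - q z"
    have D: "0 \<le> D" using v(2)[of z] by (simp add: D_def)
    have *: "2 * \<epsilon> * c \<le> \<epsilon>\<^sup>2 * D" for \<epsilon>
    proof -
      have qe: "q (\<lambda>s. v s + \<epsilon> * z s) = q v + 2 * \<epsilon> * B z + \<epsilon>\<^sup>2 * q z"
        unfolding q_def B_def ip_add_right ip_scale_right
        by (simp add: power2_eq_square algebra_simps sum.distrib sum_distrib_left)
      have ie: "ip K (\<lambda>s. v s + \<epsilon> * z s) (\<lambda>s. v s + \<epsilon> * z s) = 1 + 2 * \<epsilon> * ip K v z + \<epsilon>\<^sup>2 * ip K z z"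
        using v(1) by (simp add: ip_add_left ip_add_right ip_scale_left ip_scale_right
            ip_commute[of K z v] power2_eq_square algebra_simps)
      show ?thesis using v(2)[of "\<lambda>s. v s + \<epsilon> * z s"] unfolding qe ie c_def D_def
        by (simp add: algebra_simps)
    qed
    \<comment> \<open>A step of this size would increase the form beyond its maximum unless \<open>c = 0\<close>.\<close>
    define \<epsilon> where "\<epsilon> = c / (D + 1)"
    have c: "c = \<epsilon> * (D + 1)" using D by (simp add: \<epsilon>_def)
    have "2 * \<epsilon>\<^sup>2 * (D + 1) \<le> \<epsilon>\<^sup>2 * D"
      using *[of \<epsilon>] unfolding c by (simp add: power2_eq_square algebra_simps)
    moreover have "0 \<le> \<epsilon>\<^sup>2 * D" using D by simp
    moreover have "2 * \<epsilon>\<^sup>2 * (D + 1) = 2 * (\<epsilon>\<^sup>2 * D) + 2 * \<epsilon>\<^sup>2" by (simp add: algebra_simps)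
    ultimately have "2 * \<epsilon>\<^sup>2 \<le> 0" by linarith
    then have "c = 0" by (simp add: c)
    then show ?thesis by (simp add: c_def)
  qed
  have "q v * (ip K z v)\<^sup>2 \<le> q z" for z
  proof (cases "q v = 0")
    case True
    then show ?thesis by (simp add: q_def sum_nonneg)
  next
    case False
    have "0 \<le> q v" by (simp add: q_def sum_nonneg)
    then have p: "q v > 0" using False by simp
    have "(B z)\<^sup>2 \<le> q v * q z" unfolding B_def q_def by (rule Cauchy_Schwarz_ineq_sum)
    then have "q v * (q v * (ip K v z)\<^sup>2) \<le> q v * q z"
      unfolding eigen by (simp add: power2_eq_square algebra_simps)
    then show ?thesis using p by (simp add: ip_commute[of K z v])
  qed
  then show ?thesis using v unfolding q_def
    by (intro exI[of _ v] exI[of _ "\<Sum>i\<in>I. (ip K (g i) v)\<^sup>2"]) (auto simp: sum_nonneg)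
qed

lemma sum_half_pow_sq_le: "(\<Sum>z\<in>{- int M..int M}. (1/2::real) ^ nat (z\<^sup>2)) \<le> 3 - 2 * (1/2) ^ M"
proof (induction M)
  case 0
  then show ?case by simp
next
  case (Suc M)
  have eq: "{- int (Suc M)..int (Suc M)} = insert (- int (Suc M)) (insert (int (Suc M)) {- int M..int M})"
    by auto
  have le: "(1/2::real) ^ nat ((int (Suc M))\<^sup>2) \<le> (1/2) ^ Suc M"
  proof (rule power_decreasing)
    show "Suc M \<le> nat ((int (Suc M))\<^sup>2)" 
      using of_nat_power[of "Suc M" 2, where 'a = int] by (metis nat_int self_le_power le_add1 plus_1_eq_Suc pos2)
  qed auto
  have "(\<Sum>z\<in>{- int (Suc M)..int (Suc M)}. (1/2::real) ^ nat (z\<^sup>2))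
      = 2 * (1/2) ^ nat ((int (Suc M))\<^sup>2) + (\<Sum>z\<in>{- int M..int M}. (1/2) ^ nat (z\<^sup>2))"
  proof -
    have "(\<Sum>z\<in>insert (- int (Suc M)) (insert (int (Suc M)) {- int M..int M}). f (z\<^sup>2))
        = f ((int (Suc M))\<^sup>2) + (f ((int (Suc M))\<^sup>2) + (\<Sum>z\<in>{- int M..int M}. f (z\<^sup>2)))"
      for f :: "int \<Rightarrow> real"
      using power2_minus[of "int (Suc M)"] by (simp del: power2_minus of_nat_Suc)
    from this[of "\<lambda>u. (1/2) ^ nat u"] show ?thesis unfolding eq by simp
  qed
  also have "\<dots> \<le> 2 * (1/2) ^ Suc M + (3 - 2 * (1/2) ^ M)" using le Suc by linarith
  also have "\<dots> = 3 - 2 * (1/2) ^ Suc M" by simp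
  finally show ?case .
qed

text \<open>The integer points of squared norm at most \<open>9/4\<close> times the dimension. The box in the definition is
  implied by the norm bound; it only makes finiteness immediate.\<close>

definition lattice_points :: "'b set \<Rightarrow> ('b \<Rightarrow> int) set" where
  "lattice_points K = {z \<in> PiE K (\<lambda>_. {- int (9 * card K)..int (9 * card K)}).
     4 * (\<Sum>s\<in>K. (z s)\<^sup>2) \<le> 9 * int (card K)}"

lemma finite_lattice_points: "finite K \<Longrightarrow> finite (lattice_points K)"
  unfolding lattice_points_def
  by (rule finite_subset[of _ "PiE K (\<lambda>_. {- int (9 * card K)..int (9 * card K)})"])
    (blast, simp add: finite_PiE)

text \<open>Each point has weight \<open>2 ^ (- \<bar>z\<bar>\<^sup>2) \<ge> 5 ^ (- dim)\<close>, because \<open>2 ^ 9 \<le> 5 ^ 4\<close>, and the total weight of the integer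
  lattice is at most \<open>3 ^ dim\<close>.\<close>

lemma card_lattice_points:
  assumes K: "finite K"
  shows "card (lattice_points K) \<le> 15 ^ card K"
proof -
  let ?b = "card K" let ?R = "{- int (9 * card K)..int (9 * card K)}"
  have w: "1 \<le> 5 ^ ?b * (\<Prod>s\<in>K. (1/2::real) ^ nat ((z s)\<^sup>2))" if "z \<in> lattice_points K" for z
  proof -
    define k where "k = (\<Sum>s\<in>K. nat ((z s)\<^sup>2))"
    have "int k = (\<Sum>s\<in>K. (z s)\<^sup>2)" unfolding k_def by simp
    then have "4 * int k \<le> 9 * int ?b" using that unfolding lattice_points_def by auto
    then have k: "k * 4 \<le> 9 * ?b" by linarith
    have "(2 ^ k) ^ 4 \<le> (2::real) ^ (9 * ?b)"
      unfolding power_mult[symmetric] using k by (rule power_increasing) simp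
    also have "\<dots> = 512 ^ ?b" by (simp add: power_mult)
    also have "\<dots> \<le> 625 ^ ?b" by (rule power_mono) auto
    also have "\<dots> = (5 ^ 4) ^ ?b" by simp
    also have "\<dots> = (5 ^ ?b) ^ 4" by (simp only: power_mult[symmetric] mult.commute)
    finally have "(2::real) ^ k \<le> 5 ^ ?b" by (rule power_mono_iff[THEN iffD1, rotated 3]) auto
    moreover have "(\<Prod>s\<in>K. (1/2::real) ^ nat ((z s)\<^sup>2)) = (1/2) ^ k"
      unfolding k_def by (simp add: power_sum)
    moreover have "(2::real) ^ k * (1/2) ^ k = 1" by (simp add: power_mult_distrib[symmetric])
    ultimately show ?thesis using mult_right_mono[of "2 ^ k" "5 ^ ?b" "(1/2::real) ^ k"] by simp
  qed
  have "real (card (lattice_points K)) = (\<Sum>z\<in>lattice_points K. 1)" by simp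
  also have "\<dots> \<le> (\<Sum>z\<in>lattice_points K. 5 ^ ?b * (\<Prod>s\<in>K. (1/2::real) ^ nat ((z s)\<^sup>2)))"
    using w by (rule sum_mono)
  also have "\<dots> \<le> (\<Sum>z\<in>PiE K (\<lambda>_. ?R). 5 ^ ?b * (\<Prod>s\<in>K. (1/2::real) ^ nat ((z s)\<^sup>2)))"
    by (rule sum_mono2) (auto simp: lattice_points_def K intro!: finite_PiE mult_nonneg_nonneg prod_nonneg)
  also have "\<dots> = 5 ^ ?b * (\<Prod>s\<in>K. \<Sum>z\<in>?R. (1/2::real) ^ nat (z\<^sup>2))"
    by (subst prod_sum_PiE) (auto simp: K sum_distrib_left)
  also have "\<dots> \<le> 5 ^ ?b * (\<Prod>s\<in>K. 3)"
  proof (intro mult_left_mono prod_mono conjI)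
    fix s
    have "(0::real) \<le> 2 * (1/2) ^ (9 * card K)" by simp
    then show "(\<Sum>z\<in>?R. (1/2::real) ^ nat (z\<^sup>2)) \<le> 3"
      using sum_half_pow_sq_le[of "9 * card K"] by linarith
  qed (auto intro: sum_nonneg)
  also have "\<dots> = 15 ^ ?b" by (simp add: power_mult_distrib[symmetric])
  finally show ?thesis by (simp flip: of_nat_le_iff)
qed

text \<open>Every unit vector makes an angle with squared cosine at least \<open>3/4\<close> with one of at most \<open>15 ^ dim\<close>
  normalized integer points: scale it to length \<open>sqrt dim\<close> and round each coordinate. Bounding the elements by \<open>1\<close>
  rather than normalizing them exactly admits the zero vector, so that the net is nonempty in dimension \<open>0\<close>.\<close>

lemma cap_net:
  assumes K: "finite K"
  shows "\<exists>N. finite N \<and> card N \<le> 15 ^ card K \<and> N \<noteq> {} \<and> (\<forall>z\<in>N. ip K z z \<le> 1) \<and>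
           (\<forall>v. ip K v v = 1 \<longrightarrow> (\<exists>z\<in>N. 3 / 4 \<le> (ip K z v)\<^sup>2))"
proof -
  define nz where "nz = (\<lambda>(z::'a \<Rightarrow> int) s. (1 / sqrt (ip K (\<lambda>s. real_of_int (z s)) (\<lambda>s. real_of_int (z s)))) * real_of_int (z s))"
  define N where "N = nz ` lattice_points K"
  have "(\<lambda>s\<in>K. 0) \<in> lattice_points K" unfolding lattice_points_def by auto
  then have "N \<noteq> {}" unfolding N_def by blast
  moreover have "finite N" unfolding N_def using finite_lattice_points[OF K] by blast
  moreover have "card N \<le> 15 ^ card K" unfolding N_def
    using card_image_le[OF finite_lattice_points[OF K], of nz] card_lattice_points[OF K] by linarith
  moreover have "ip K y y \<le> 1" if yN: "y \<in> N" for y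
  proof -
    obtain z where y: "y = nz z" using yN unfolding N_def by blast
    let ?n = "ip K (\<lambda>s. real_of_int (z s)) (\<lambda>s. real_of_int (z s))"
    have "ip K y y = (1 / sqrt ?n) * ((1 / sqrt ?n) * ?n)"
      unfolding y nz_def ip_scale_left ip_scale_right ..
    also have "\<dots> \<le> 1" using ip_nonneg[of K "\<lambda>s. real_of_int (z s)"] by (cases "?n = 0") (auto simp: field_simps)
    finally show ?thesis .
  qed
  moreover have "\<exists>z\<in>N. 3 / 4 \<le> (ip K z v)\<^sup>2" if v: "ip K v v = 1" for v
  proof -
    define b where "b = real (card K)"
    define r where "r = sqrt b"
    have "K \<noteq> {}" using v by (auto simp: ip_def)
    then have b: "b > 0" unfolding b_def using K by (simp add: card_gt_0_iff)
    have r: "r > 0" "r * r = b" using b by (auto simp: r_def)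
    define z where "z = (\<lambda>s\<in>K. \<lfloor>r * v s + 1/2\<rfloor>)"
    define Z where "Z = (\<lambda>s. real_of_int (z s))"
    define e where "e = (\<lambda>s. Z s - r * v s)"
    have e: "\<bar>e s\<bar> \<le> 1/2" if "s \<in> K" for s
    proof -
      have "e s = of_int \<lfloor>r * v s + 1/2\<rfloor> - r * v s" using that by (simp add: e_def Z_def z_def)
      then show ?thesis using floor_correct[of "r * v s + 1/2"] by linarith
    qed
    define a where "a = ip K e v"
    define E where "E = ip K e e"
    have "E \<le> (\<Sum>s\<in>K. 1/4)" unfolding E_def ip_self_eq
    proof (rule sum_mono)
      fix s assume "s \<in> K"
      then have "\<bar>e s\<bar>\<^sup>2 \<le> (1/2)\<^sup>2" using e by (intro power_mono) auto
      then show "(e s)\<^sup>2 \<le> 1/4" by (simp add: power_divide)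
    qed
    then have E: "E \<le> b / 4" by (simp add: b_def)
    have a2: "a\<^sup>2 \<le> E" using ip_cauchy_schwarz[of K e v] v unfolding a_def E_def by simp
    then have "a\<^sup>2 \<le> (r / 2)\<^sup>2" using E r by (simp add: power2_eq_square field_simps)
    then have ar: "\<bar>a\<bar> \<le> r / 2" using r by (simp add: abs_le_square_iff[symmetric])
    have Zv: "ip K Z v = r + a"
    proof -
      have "a = ip K Z v - r * ip K v v" unfolding a_def e_def ip_diff_left ip_scale_left ..
      then show ?thesis using v by simp
    qed
    have ZZ: "ip K Z Z = b + 2 * r * a + E"
    proof -
      have "E = ip K Z Z - 2 * r * ip K Z v + r * r * ip K v v"
        unfolding E_def e_def ip_diff_left ip_diff_right ip_scale_left ip_scale_right
        by (simp add: ip_commute[of K v Z])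
      then show ?thesis using Zv v r by (simp add: algebra_simps)
    qed
    have ra: "r * a \<le> b / 2"
    proof -
      have "r * a \<le> r * (r / 2)" using ar r by (intro mult_left_mono) auto
      then show ?thesis using r by simp
    qed
    have "ip K Z Z \<le> 9 * b / 4" using ZZ ra E by linarith
    then have "4 * (\<Sum>s\<in>K. (real_of_int (z s))\<^sup>2) \<le> 9 * real (card K)" unfolding ip_self_eq Z_def b_def by simp
    then have "real_of_int (4 * (\<Sum>s\<in>K. (z s)\<^sup>2)) \<le> real_of_int (9 * int (card K))" by simp
    then have s4: "4 * (\<Sum>s\<in>K. (z s)\<^sup>2) \<le> 9 * int (card K)" by linarith
    have "\<bar>z s\<bar> \<le> 9 * int (card K)" if "s \<in> K" for s
    proof -
      have "\<bar>z s\<bar> \<le> (z s)\<^sup>2"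
      proof (cases "z s = 0")
        case False
        then have "1 * \<bar>z s\<bar> \<le> \<bar>z s\<bar> * \<bar>z s\<bar>" by (intro mult_right_mono) auto
        then show ?thesis by (simp add: power2_eq_square abs_mult_self_eq)
      qed simp
      also have "\<dots> \<le> (\<Sum>s\<in>K. (z s)\<^sup>2)" using K that by (intro member_le_sum) auto
      also have "\<dots> \<le> 9 * int (card K)" using s4 sum_nonneg[of K "\<lambda>s. (z s)\<^sup>2"] by auto
      finally show ?thesis .
    qed
    then have "z \<in> lattice_points K" unfolding lattice_points_def using s4
      by (auto simp: PiE_iff abs_le_iff z_def extensional_def) (smt (verit))+
    then have "nz z \<in> N" unfolding N_def by blast
    moreover have "3 / 4 \<le> (ip K (nz z) v)\<^sup>2"
    proof -
      have "(r + a)\<^sup>2 \<ge> (r / 2)\<^sup>2" using ar r by (intro power_mono) auto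
      then have "(r + a)\<^sup>2 > 0" using r by (smt (verit) zero_less_power divide_pos_pos)
      moreover have "(r + a)\<^sup>2 \<le> ip K Z Z" using ip_cauchy_schwarz[of K Z v] v Zv by simp
      ultimately have ZZ0: "ip K Z Z > 0" by linarith
      \<comment> \<open>The constant \<open>3/4\<close> is the one for which the remaining quadratic in \<open>a\<close> is a perfect square.\<close>
      have "0 \<le> (r / 4 + a)\<^sup>2" by simp
      also have "\<dots> = (r + a)\<^sup>2 - 3 / 4 * (b + 2 * r * a + b / 4)"
        using r(2) by (simp add: power2_eq_square algebra_simps)
      also have "\<dots> \<le> (r + a)\<^sup>2 - 3 / 4 * ip K Z Z" using ZZ E by simp
      finally have "3 / 4 * ip K Z Z \<le> (r + a)\<^sup>2" by simp
      moreover have "(ip K (nz z) v)\<^sup>2 = (r + a)\<^sup>2 / ip K Z Z"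
        using ZZ0 unfolding nz_def ip_scale_left Z_def[symmetric]
        by (simp add: Zv power_divide)
      ultimately show ?thesis using ZZ0 by (simp add: le_divide_eq)
    qed
    ultimately show ?thesis by blast
  qed
  ultimately show ?thesis by blast
qed

text \<open>One net serves for all quadratic forms: the squared operator norm is at most \<open>4/3\<close> times the value of the form
  at some element of the net.\<close>

lemma operator_norm_net:
  assumes K: "finite (K :: 'b set)"
  shows "\<exists>N. finite N \<and> card N \<le> 15 ^ card K \<and> (\<forall>z\<in>N. ip K z z \<le> 1) \<and>
    (\<forall>(I :: 'a set) g. finite I \<longrightarrow> (\<exists>z\<in>N. \<forall>v. (\<Sum>i\<in>I. (ip K (g i) v)\<^sup>2)
        \<le> 4 / 3 * (\<Sum>i\<in>I. (ip K (g i) z)\<^sup>2) * ip K v v))"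
proof -
  obtain N where N: "finite N" "card N \<le> 15 ^ card K" "N \<noteq> {}" "\<forall>z\<in>N. ip K z z \<le> 1"
    and cap: "\<And>v. ip K v v = 1 \<Longrightarrow> \<exists>z\<in>N. 3 / 4 \<le> (ip K z v)\<^sup>2"
    using cap_net[OF K] by blast
  have "\<exists>z\<in>N. \<forall>v. (\<Sum>i\<in>I. (ip K (g i) v)\<^sup>2) \<le> 4 / 3 * (\<Sum>i\<in>I. (ip K (g i) z)\<^sup>2) * ip K v v"
    if I: "finite I" for I :: "'a set" and g
  proof (cases "K = {}")
    case True
    then show ?thesis using N(3) by (auto simp: ip_def)
  next
    case False
    obtain v \<mu> where v: "ip K v v = 1" "0 \<le> \<mu>" "\<And>x. (\<Sum>i\<in>I. (ip K (g i) x)\<^sup>2) \<le> \<mu> * ip K x x"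
      "\<And>z. \<mu> * (ip K z v)\<^sup>2 \<le> (\<Sum>i\<in>I. (ip K (g i) z)\<^sup>2)"
      using top_singular_direction[OF I K False, of g] by blast
    obtain z where z: "z \<in> N" "3 / 4 \<le> (ip K z v)\<^sup>2" using cap[OF v(1)] by blast
    have "\<mu> * (3 / 4) \<le> \<mu> * (ip K z v)\<^sup>2" using z(2) v(2) by (rule mult_left_mono)
    then have "\<mu> \<le> 4 / 3 * (\<Sum>i\<in>I. (ip K (g i) z)\<^sup>2)" using v(4)[of z] by linarith
    then have "\<mu> * ip K x x \<le> 4 / 3 * (\<Sum>i\<in>I. (ip K (g i) z)\<^sup>2) * ip K x x" for x
      by (rule mult_right_mono) simp
    with v(3) z(1) show ?thesis by (meson order_trans)
  qed
  then show ?thesis using N by blast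
qed

section \<open>Exponential moments of Gaussian coordinates\<close>

lemma nn_integral_normal_density: "0 < \<sigma> \<Longrightarrow> (\<integral>\<^sup>+x. ennreal (normal_density \<mu> \<sigma> x) \<partial>lborel) = 1"
  by (simp add: nn_integral_eq_integral normal_density_nonneg)

lemma normal_mgf:
  assumes "0 < \<sigma>"
  shows "(\<integral>\<^sup>+x. ennreal (normal_density 0 \<sigma> x) * ennreal (exp (t * x)) \<partial>lborel) = ennreal (exp (\<sigma>\<^sup>2 * t\<^sup>2 / 2))"
proof -
  have *: "normal_density 0 \<sigma> x * exp (t * x) = exp (\<sigma>\<^sup>2 * t\<^sup>2 / 2) * normal_density (\<sigma>\<^sup>2 * t) \<sigma> x" for x
  proof -
    have "- (x\<^sup>2) / (2 * \<sigma>\<^sup>2) + t * x = \<sigma>\<^sup>2 * t\<^sup>2 / 2 + - ((x - \<sigma>\<^sup>2 * t)\<^sup>2) / (2 * \<sigma>\<^sup>2)"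
      using assms by (simp add: field_simps power2_eq_square)
    then have "exp (- (x\<^sup>2) / (2 * \<sigma>\<^sup>2)) * exp (t * x) = exp (\<sigma>\<^sup>2 * t\<^sup>2 / 2) * exp (- ((x - \<sigma>\<^sup>2 * t)\<^sup>2) / (2 * \<sigma>\<^sup>2))"
      by (simp only: exp_add[symmetric])
    then show ?thesis unfolding normal_density_def by simp
  qed
  have "(\<integral>\<^sup>+x. ennreal (normal_density 0 \<sigma> x) * ennreal (exp (t * x)) \<partial>lborel)
     = (\<integral>\<^sup>+x. ennreal (exp (\<sigma>\<^sup>2 * t\<^sup>2 / 2)) * ennreal (normal_density (\<sigma>\<^sup>2 * t) \<sigma> x) \<partial>lborel)"
    by (simp only: ennreal_mult'[symmetric] normal_density_nonneg exp_ge_zero *)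
  also have "\<dots> = ennreal (exp (\<sigma>\<^sup>2 * t\<^sup>2 / 2))"
    by (simp add: nn_integral_cmult nn_integral_normal_density assms)
  finally show ?thesis .
qed

lemma std_normal_exp_square:
  assumes "a < 1 / 2"
  shows "(\<integral>\<^sup>+y. ennreal (std_normal_density y) * ennreal (exp (a * y\<^sup>2)) \<partial>lborel) = ennreal (1 / sqrt (1 - 2 * a))"
proof -
  define \<tau> where "\<tau> = 1 / sqrt (1 - 2 * a)"
  have \<tau>: "\<tau> > 0" "\<tau>\<^sup>2 = 1 / (1 - 2 * a)" using assms by (auto simp: \<tau>_def power_divide)
  have *: "std_normal_density y * exp (a * y\<^sup>2) = \<tau> * normal_density 0 \<tau> y" for y
  proof -
    have "- (y\<^sup>2) / 2 + a * y\<^sup>2 = - (y - 0)\<^sup>2 / (2 * \<tau>\<^sup>2)"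
      unfolding \<tau>(2) using assms by (simp add: field_simps)
    then have "exp (- (y\<^sup>2) / 2) * exp (a * y\<^sup>2) = exp (- (y - 0)\<^sup>2 / (2 * \<tau>\<^sup>2))"
      by (simp only: exp_add[symmetric])
    moreover have "sqrt (2 * pi * \<tau>\<^sup>2) = sqrt (2 * pi) * \<tau>" using \<tau>(1) by (simp add: real_sqrt_mult)
    ultimately show ?thesis unfolding std_normal_density_def normal_density_def
      using \<tau>(1) by (simp add: field_simps)
  qed
  have "(\<integral>\<^sup>+y. ennreal (std_normal_density y) * ennreal (exp (a * y\<^sup>2)) \<partial>lborel)
    = (\<integral>\<^sup>+y. ennreal \<tau> * ennreal (normal_density 0 \<tau> y) \<partial>lborel)"
    using \<tau>(1) by (simp only: ennreal_mult'[symmetric] normal_density_nonneg exp_ge_zero * less_imp_le)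
  also have "\<dots> = ennreal \<tau>" using \<tau>(1) by (simp add: nn_integral_cmult nn_integral_normal_density)
  finally show ?thesis unfolding \<tau>_def .
qed

text \<open>A random vector indexed by \<open>S\<close> whose entries are independent and \<open>N(0, \<sigma>\<^sup>2)\<close>.\<close>

locale gaussian_vector = prob_space M
  for M :: "'w measure" and S :: "'i set" and \<sigma> :: real and e :: "'i \<Rightarrow> 'w \<Rightarrow> real" +
  assumes finite_S: "finite S" and sigma_pos: "0 < \<sigma>"
    and indep_e: "indep_vars (\<lambda>_. borel) e S"
    and normal_e: "s \<in> S \<Longrightarrow> distributed M lborel (e s) (normal_density 0 \<sigma>)"
begin

text \<open>The coordinate of the random vector in the direction \<open>f\<close>.\<close>

definition coord :: "('i \<Rightarrow> real) \<Rightarrow> 'w \<Rightarrow> real" where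
  "coord f \<omega> = ip S f (\<lambda>s. e s \<omega>)"

lemma e_measurable [measurable]: "s \<in> S \<Longrightarrow> e s \<in> borel_measurable M"
  using indep_e unfolding indep_vars_def by auto

lemma coord_measurable [measurable]: "coord f \<in> borel_measurable M"
  unfolding coord_def[abs_def] ip_def by measurable

lemma coord_add: "coord (\<lambda>s. f s + c * g s) \<omega> = coord f \<omega> + c * coord g \<omega>"
  unfolding coord_def ip_add_left ip_scale_left ..

lemma nn_integral_exp_coord:
  "(\<integral>\<^sup>+\<omega>. ennreal (exp (coord f \<omega>)) \<partial>M) = ennreal (exp (\<sigma>\<^sup>2 / 2 * ip S f f))"
proof -
  have "(\<integral>\<^sup>+\<omega>. ennreal (exp (coord f \<omega>)) \<partial>M) = (\<integral>\<^sup>+\<omega>. (\<Prod>s\<in>S. ennreal (exp (f s * e s \<omega>))) \<partial>M)"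
    unfolding coord_def ip_def exp_sum[OF finite_S] by (simp add: prod_ennreal)
  also have "\<dots> = (\<Prod>s\<in>S. \<integral>\<^sup>+\<omega>. ennreal (exp (f s * e s \<omega>)) \<partial>M)"
  proof (rule indep_vars_nn_integral[OF finite_S])
    show "indep_vars (\<lambda>_. borel) (\<lambda>s \<omega>. ennreal (exp (f s * e s \<omega>))) S"
      by (rule indep_vars_compose2[OF indep_e, where Y = "\<lambda>s x. ennreal (exp (f s * x))"]) simp
  qed simp
  also have "\<dots> = (\<Prod>s\<in>S. ennreal (exp (\<sigma>\<^sup>2 * (f s)\<^sup>2 / 2)))"
  proof (rule prod.cong[OF refl])
    fix s assume s: "s \<in> S"
    have "(\<integral>\<^sup>+\<omega>. ennreal (exp (f s * e s \<omega>)) \<partial>M) = (\<integral>\<^sup>+x. ennreal (normal_density 0 \<sigma> x) * ennreal (exp (f s * x)) \<partial>lborel)"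
      by (rule distributed_nn_integral[OF normal_e[OF s], symmetric]) simp
    then show "(\<integral>\<^sup>+\<omega>. ennreal (exp (f s * e s \<omega>)) \<partial>M) = ennreal (exp (\<sigma>\<^sup>2 * (f s)\<^sup>2 / 2))"
      using normal_mgf[OF sigma_pos] by simp
  qed
  also have "\<dots> = ennreal (exp (\<sigma>\<^sup>2 / 2 * ip S f f))"
    by (simp add: prod_ennreal exp_sum[OF finite_S, symmetric] ip_self_eq sum_distrib_left)
  finally show ?thesis .
qed

text \<open>The chi-square bound: the squares of the coordinates in orthogonal directions of length at most \<open>1\<close> have
  the joint exponential moment bound of independent squares. Rotation invariance of the Gaussian law is avoided by writing each \<open>exp (x\<^sup>2 / (3 \<sigma>\<^sup>2))\<close> as
  an average of \<open>exp (c x y)\<close> over a standard normal \<open>y\<close>; this reduces the claim, one direction at a time, to the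
  moment generating function of a single coordinate. The linear term \<open>g\<close> carries the induction.\<close>

lemma nn_integral_exp_sum_squares:
  assumes "finite I"
    and "\<And>i j. i \<in> I \<Longrightarrow> j \<in> I \<Longrightarrow> i \<noteq> j \<Longrightarrow> ip S (f i) (f j) = 0"
    and "\<And>i. i \<in> I \<Longrightarrow> ip S (f i) (f i) \<le> 1"
    and "\<And>i. i \<in> I \<Longrightarrow> ip S (f i) g = 0"
  shows "(\<integral>\<^sup>+\<omega>. ennreal (exp ((\<Sum>i\<in>I. (coord (f i) \<omega>)\<^sup>2) / (3 * \<sigma>\<^sup>2) + coord g \<omega>)) \<partial>M)
    \<le> ennreal (sqrt 3 ^ card I * exp (\<sigma>\<^sup>2 / 2 * ip S g g))"
  using assms
proof (induction I arbitrary: g rule: finite_induct)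
  case empty
  then show ?case by (simp add: nn_integral_exp_coord)
next
  case (insert k I)
  interpret P: pair_sigma_finite M lborel
    by unfold_locales
  define c where "c = sqrt (2 / 3) / \<sigma>"
  have c2: "c\<^sup>2 = 2 / (3 * \<sigma>\<^sup>2)" unfolding c_def by (simp add: power_divide)
  define A where "A = (\<lambda>\<omega>. (\<Sum>i\<in>I. (coord (f i) \<omega>)\<^sup>2) / (3 * \<sigma>\<^sup>2))"
  have [measurable]: "A \<in> borel_measurable M" unfolding A_def by measurable
  let ?\<phi> = "ip S (f k) (f k)"
  have \<phi>: "?\<phi> \<le> 1" using insert.prems(2) by simp
  \<comment> \<open>The square in the exponent is linearized by an auxiliary standard normal variable.\<close>
  have hs: "ennreal (exp ((coord (f k) \<omega>)\<^sup>2 / (3 * \<sigma>\<^sup>2)))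
      = (\<integral>\<^sup>+y. ennreal (std_normal_density y) * ennreal (exp (c * coord (f k) \<omega> * y)) \<partial>lborel)" for \<omega>
    using normal_mgf[of 1 "c * coord (f k) \<omega>"] by (simp add: power_mult_distrib c2)
  have "(\<integral>\<^sup>+\<omega>. ennreal (exp ((\<Sum>i\<in>insert k I. (coord (f i) \<omega>)\<^sup>2) / (3 * \<sigma>\<^sup>2) + coord g \<omega>)) \<partial>M)
     = (\<integral>\<^sup>+\<omega>. ennreal (exp (A \<omega> + coord g \<omega>)) * ennreal (exp ((coord (f k) \<omega>)\<^sup>2 / (3 * \<sigma>\<^sup>2))) \<partial>M)"
    using insert.hyps unfolding A_def
    by (simp add: ennreal_mult'[symmetric] exp_add[symmetric] add_divide_distrib algebra_simps)
  also have "\<dots> = (\<integral>\<^sup>+\<omega>. \<integral>\<^sup>+y. ennreal (exp (A \<omega> + coord g \<omega>)) *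
        (ennreal (std_normal_density y) * ennreal (exp (c * coord (f k) \<omega> * y))) \<partial>lborel \<partial>M)"
    unfolding hs by (intro nn_integral_cong nn_integral_cmult[symmetric]) measurable
  also have "\<dots> = (\<integral>\<^sup>+y. \<integral>\<^sup>+\<omega>. ennreal (exp (A \<omega> + coord g \<omega>)) *
        (ennreal (std_normal_density y) * ennreal (exp (c * coord (f k) \<omega> * y))) \<partial>M \<partial>lborel)"
    by (rule P.Fubini'[symmetric]) measurable
  also have "\<dots> = (\<integral>\<^sup>+y. ennreal (std_normal_density y) *
        (\<integral>\<^sup>+\<omega>. ennreal (exp (A \<omega> + coord (\<lambda>s. g s + (c * y) * f k s) \<omega>)) \<partial>M) \<partial>lborel)"
  proof (rule nn_integral_cong)
    fix y
    have "ennreal (exp (A \<omega> + coord g \<omega>)) * (ennreal (std_normal_density y) * ennreal (exp (c * coord (f k) \<omega> * y)))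
      = ennreal (std_normal_density y) * ennreal (exp (A \<omega> + coord (\<lambda>s. g s + (c * y) * f k s) \<omega>))" for \<omega>
      unfolding coord_add by (simp add: ennreal_mult'[symmetric] exp_add algebra_simps)
    then show "(\<integral>\<^sup>+\<omega>. ennreal (exp (A \<omega> + coord g \<omega>)) *
        (ennreal (std_normal_density y) * ennreal (exp (c * coord (f k) \<omega> * y))) \<partial>M) =
      ennreal (std_normal_density y) *
        (\<integral>\<^sup>+\<omega>. ennreal (exp (A \<omega> + coord (\<lambda>s. g s + (c * y) * f k s) \<omega>)) \<partial>M)"
      by (simp add: nn_integral_cmult)
  qed
  also have "\<dots> \<le> (\<integral>\<^sup>+y. ennreal (sqrt 3 ^ card I * exp (\<sigma>\<^sup>2 / 2 * ip S g g)) *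
        (ennreal (std_normal_density y) * ennreal (exp (?\<phi> / 3 * y\<^sup>2))) \<partial>lborel)"
  proof (rule nn_integral_mono)
    fix y :: real
    let ?g = "\<lambda>s. g s + (c * y) * f k s"
    have orth: "ip S (f i) ?g = 0" if "i \<in> I" for i
      unfolding ip_add_right ip_scale_right using insert.prems(1)[of i k] insert.prems(3)[of i] insert.hyps that
      by auto
    have gg: "ip S ?g ?g = ip S g g + c\<^sup>2 * y\<^sup>2 * ?\<phi>"
      using insert.prems(3)[of k]
      by (simp add: ip_add_right ip_scale_right ip_add_left ip_scale_left ip_commute[of S g "f k"] power2_eq_square)
    have "(\<integral>\<^sup>+\<omega>. ennreal (exp (A \<omega> + coord ?g \<omega>)) \<partial>M) \<le> ennreal (sqrt 3 ^ card I * exp (\<sigma>\<^sup>2 / 2 * ip S ?g ?g))"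
      unfolding A_def using insert.prems orth by (intro insert.IH) auto
    also have "exp (\<sigma>\<^sup>2 / 2 * ip S ?g ?g) = exp (\<sigma>\<^sup>2 / 2 * ip S g g) * exp (?\<phi> / 3 * y\<^sup>2)"
      unfolding gg c2 using sigma_pos by (simp add: exp_add[symmetric] field_simps)
    finally have "ennreal (std_normal_density y) * (\<integral>\<^sup>+\<omega>. ennreal (exp (A \<omega> + coord ?g \<omega>)) \<partial>M)
      \<le> ennreal (std_normal_density y) * ennreal (sqrt 3 ^ card I * (exp (\<sigma>\<^sup>2 / 2 * ip S g g) * exp (?\<phi> / 3 * y\<^sup>2)))"
      by (rule mult_left_mono) simp
    also have "\<dots> = ennreal (sqrt 3 ^ card I * exp (\<sigma>\<^sup>2 / 2 * ip S g g)) *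
        (ennreal (std_normal_density y) * ennreal (exp (?\<phi> / 3 * y\<^sup>2)))"
      by (simp add: ennreal_mult'[symmetric] mult_ac)
    finally show "ennreal (std_normal_density y) * (\<integral>\<^sup>+\<omega>. ennreal (exp (A \<omega> + coord ?g \<omega>)) \<partial>M)
      \<le> ennreal (sqrt 3 ^ card I * exp (\<sigma>\<^sup>2 / 2 * ip S g g)) *
        (ennreal (std_normal_density y) * ennreal (exp (?\<phi> / 3 * y\<^sup>2)))" .
  qed
  also have "\<dots> = ennreal (sqrt 3 ^ card I * exp (\<sigma>\<^sup>2 / 2 * ip S g g)) * ennreal (1 / sqrt (1 - 2 * (?\<phi> / 3)))"
    using \<phi> by (subst nn_integral_cmult) (auto simp: std_normal_exp_square[of "?\<phi> / 3", simplified])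
  also have "\<dots> \<le> ennreal (sqrt 3 ^ card I * exp (\<sigma>\<^sup>2 / 2 * ip S g g)) * ennreal (sqrt 3)"
  proof (intro mult_left_mono ennreal_leI)
    have "sqrt (1 / 3) \<le> sqrt (1 - 2 * (?\<phi> / 3))" using \<phi> by simp
    moreover have "0 < sqrt (1 / 3 :: real)" by simp
    ultimately have "1 / sqrt (1 - 2 * (?\<phi> / 3)) \<le> 1 / sqrt (1 / 3)" by (intro divide_left_mono mult_pos_pos) linarith+
    then show "1 / sqrt (1 - 2 * (?\<phi> / 3)) \<le> sqrt 3" by (simp add: real_sqrt_divide)
  qed simp
  also have "\<dots> = ennreal (sqrt 3 ^ card (insert k I) * exp (\<sigma>\<^sup>2 / 2 * ip S g g))"
    using insert.hyps by (simp add: ennreal_mult'[symmetric] mult_ac)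
  finally show ?case .
qed

lemma nn_integral_coord_square_le:
  assumes "ip S f f \<le> 1"
  shows "(\<integral>\<^sup>+\<omega>. ennreal ((coord f \<omega>)\<^sup>2) \<partial>M) \<le> ennreal (6 * \<sigma>\<^sup>2)"
proof -
  have "(\<integral>\<^sup>+\<omega>. ennreal ((coord f \<omega>)\<^sup>2) \<partial>M)
    \<le> (\<integral>\<^sup>+\<omega>. ennreal (3 * \<sigma>\<^sup>2) * ennreal (exp ((\<Sum>i\<in>{()}. (coord f \<omega>)\<^sup>2) / (3 * \<sigma>\<^sup>2) + coord (\<lambda>_. 0) \<omega>)) \<partial>M)"
  proof (rule nn_integral_mono)
    fix \<omega>
    let ?x = "(coord f \<omega>)\<^sup>2"
    have "1 + ?x / (3 * \<sigma>\<^sup>2) \<le> exp (?x / (3 * \<sigma>\<^sup>2))" by (rule exp_ge_add_one_self)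
    then have "?x / (3 * \<sigma>\<^sup>2) \<le> exp (?x / (3 * \<sigma>\<^sup>2))" by linarith
    then have "?x \<le> 3 * \<sigma>\<^sup>2 * exp (?x / (3 * \<sigma>\<^sup>2))" using sigma_pos by (simp add: field_simps)
    then show "ennreal ?x \<le> ennreal (3 * \<sigma>\<^sup>2) * ennreal (exp ((\<Sum>i\<in>{()}. ?x) / (3 * \<sigma>\<^sup>2) + coord (\<lambda>_. 0) \<omega>))"
      by (simp add: ennreal_mult'[symmetric] coord_def ip_def)
  qed
  also have "\<dots> = ennreal (3 * \<sigma>\<^sup>2) * (\<integral>\<^sup>+\<omega>. ennreal (exp ((\<Sum>i\<in>{()}. (coord f \<omega>)\<^sup>2) / (3 * \<sigma>\<^sup>2) + coord (\<lambda>_. 0) \<omega>)) \<partial>M)"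
    by (rule nn_integral_cmult) measurable
  also have "\<dots> \<le> ennreal (3 * \<sigma>\<^sup>2) * ennreal (sqrt 3 ^ card {()} * exp (\<sigma>\<^sup>2 / 2 * ip S (\<lambda>_. 0) (\<lambda>_. 0)))"
    using assms by (intro mult_left_mono nn_integral_exp_sum_squares) (auto simp: ip_def)
  also have "\<dots> \<le> ennreal (6 * \<sigma>\<^sup>2)"
  proof -
    have "sqrt 3 \<le> sqrt 4" by (subst real_sqrt_le_iff) simp
    then have "3 * \<sigma>\<^sup>2 * sqrt 3 \<le> 3 * \<sigma>\<^sup>2 * 2" by (intro mult_left_mono) auto
    then show ?thesis by (simp add: ennreal_mult'[symmetric] ip_def)
  qed
  finally show ?thesis .
qed

end

section \<open>Rank factorization and block decomposition\<close>

text \<open>The factor \<open>c\<close> can be taken to consist of columns of \<open>B\<close>, hence it vanishes on the zero rows of \<open>B\<close>.\<close>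

lemma rank_factorization:
  assumes B: "B \<in> carrier_mat p n"
  shows "\<exists>c d. (\<forall>i<p. \<forall>j<n. B $$ (i, j) = (\<Sum>l<mat_rank B. c l i * d l j)) \<and>
               (\<forall>l<mat_rank B. \<forall>i<p. i \<notin> nonzero_rows B \<longrightarrow> c l i = 0)"
proof -
  interpret vec_space "TYPE(real)" p .
  let ?C = "set (cols B)"
  have C: "?C \<subseteq> carrier_vec p" using B cols_dim by blast
  have "lin_indpt {}" using finite_lin_indpt2[of "{}"] by simp
  then obtain U where U: "maximal U (\<lambda>T. T \<subseteq> ?C \<and> lin_indpt T)"
    using maximal_exists_superset[of ?C "\<lambda>T. T \<subseteq> ?C \<and> lin_indpt T" "{}"] by auto
  then have UC: "U \<subseteq> ?C" "lin_indpt U" unfolding maximal_def by simp_all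
  then have fin: "finite U" using finite_subset by blast
  have Uc: "U \<subseteq> carrier_vec p" using UC C by blast
  have rk: "mat_rank B = card U" unfolding mat_rank_def using rank_card_indpt[OF B U] B by auto
  have span: "v \<in> span U" if "v \<in> ?C" for v
  proof (rule ccontr)
    assume nv: "v \<notin> span U"
    have "v \<notin> U" using nv Uc span_mem by blast
    have vc: "v \<in> carrier_vec p" using that C by blast
    have "lin_indpt (U \<union> {v})"
      using lin_dep_iff_in_span[OF Uc UC(2) vc \<open>v \<notin> U\<close>] nv by blast
    moreover have "U \<subseteq> U \<union> {v}" "U \<union> {v} \<subseteq> ?C" using UC(1) that by auto
    ultimately have "U \<union> {v} = U" using U unfolding maximal_def by blast
    then show False using \<open>v \<notin> U\<close> by blast
  qed
  have "\<forall>v\<in>?C. \<exists>a. v = lincomb a U" using span finite_in_span[OF fin Uc] by blast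
  then obtain a where a: "\<And>v. v \<in> ?C \<Longrightarrow> v = lincomb (a v) U" by metis
  obtain u where u: "bij_betw u {..<card U} U"
    using fin by (metis atLeast0LessThan ex_bij_betw_nat_finite)
  have entry: "B $$ (i, j) = (\<Sum>l<mat_rank B. u l $ i * a (col B j) (u l))" if ij: "i < p" "j < n" for i j
  proof -
    have "col B j \<in> ?C" using B ij by (auto simp: cols_def)
    then have "col B j $ i = lincomb (a (col B j)) U $ i" using a by metis
    also have "\<dots> = (\<Sum>x\<in>U. a (col B j) x * x $ i)" using lincomb_index[OF ij(1) Uc] .
    also have "\<dots> = (\<Sum>l<card U. a (col B j) (u l) * u l $ i)"
      by (rule sum.reindex_bij_betw[OF u, symmetric])
    finally show ?thesis using B ij rk by (simp add: mult.commute)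
  qed
  have zero: "u l $ i = 0" if l: "l < mat_rank B" and i: "i < p" "i \<notin> nonzero_rows B" for l i
  proof -
    have "u l \<in> U" using u l rk by (auto simp: bij_betw_def)
    then have "u l \<in> ?C" using UC(1) by blast
    then obtain j where j: "j < n" "u l = col B j" using B by (auto simp: cols_def)
    have "row B i = 0\<^sub>v n" using i B by (auto simp: nonzero_rows_def)
    then have "row B i $ j = 0" using j(1) by simp
    then show ?thesis using j i B by simp
  qed
  show ?thesis
    by (rule exI[of _ "\<lambda>l i. u l $ i"], rule exI[of _ "\<lambda>l j. a (col B j) (u l)"])
      (intro conjI allI impI entry zero)
qed

lemma mat_rank_le: "B \<in> carrier_mat p n \<Longrightarrow> mat_rank B \<le> n"
  unfolding mat_rank_def using vec_space.rank_le_nc[of B p n] by (simp add: carrier_matD)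

text \<open>The rank-one matrix \<open>x y\<^sup>T\<close>.\<close>

definition tens :: "('a \<Rightarrow> real) \<Rightarrow> ('b \<Rightarrow> real) \<Rightarrow> 'a \<times> 'b \<Rightarrow> real" where
  "tens x y = (\<lambda>(s, t). x s * y t)"

text \<open>The product of the matrix \<open>D\<close> with the vector \<open>y\<close>.\<close>

definition mv :: "'b set \<Rightarrow> ('a \<times> 'b \<Rightarrow> real) \<Rightarrow> ('b \<Rightarrow> real) \<Rightarrow> 'a \<Rightarrow> real" where
  "mv T D y = (\<lambda>s. ip T (\<lambda>t. D (s, t)) y)"

lemma ip_prod: "ip (S \<times> T) f g = (\<Sum>s\<in>S. ip T (\<lambda>t. f (s, t)) (\<lambda>t. g (s, t)))"
  unfolding ip_def sum.cartesian_product by (intro sum.cong) auto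

lemma ip_tens: "ip (S \<times> T) (tens x y) (tens x' y') = ip S x x' * ip T y y'"
  unfolding ip_prod tens_def unfolding ip_def sum_product by (intro sum.cong) auto

lemma ip_tens_mv: "ip (S \<times> T) (tens x y) G = ip S x (mv T G y)"
  unfolding ip_prod tens_def mv_def unfolding ip_def sum_distrib_left by (intro sum.cong) auto

lemma ip_mv:
  assumes q: "onf T J q" "finite J" "\<And>x. in_span T J q x"
  shows "ip (S \<times> T) G D = (\<Sum>j\<in>J. ip S (mv T G (q j)) (mv T D (q j)))"
proof -
  have "ip (S \<times> T) G D = (\<Sum>s\<in>S. \<Sum>j\<in>J. mv T G (q j) s * mv T D (q j) s)"
    unfolding ip_prod mv_def by (intro sum.cong refl parseval[OF q])
  also have "\<dots> = (\<Sum>j\<in>J. ip S (mv T G (q j)) (mv T D (q j)))"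
    unfolding ip_def by (rule sum.swap)
  finally show ?thesis .
qed

lemma mv_lincomb_tens:
  assumes "\<And>t. t \<in> T \<Longrightarrow> U (s, t) = (\<Sum>l<k. a l s * b l t)"
  shows "mv T U y s = (\<Sum>l<k. ip T (b l) y * a l s)"
proof -
  have "mv T U y s = ip T (\<lambda>t. \<Sum>l<k. a l s * b l t) y"
    unfolding mv_def by (rule ip_cong) (use assms in auto)
  then show ?thesis by (simp add: ip_sum_left mult.commute)
qed

lemma in_span_trans:
  assumes "in_span S L c x" "\<And>l. l \<in> L \<Longrightarrow> in_span S I e (c l)"
  shows "in_span S I e x"
proof -
  from assms(1) obtain a where "\<forall>s\<in>S. x s = (\<Sum>l\<in>L. a l * c l s)" unfolding in_span_def by blast
  then show ?thesis using in_span_cong[OF in_span_sum[OF assms(2), of L "\<lambda>l. l" a]] by auto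
qed

lemma young2: "2 * (c * d :: real) \<le> d\<^sup>2 / 2 + 2 * c\<^sup>2"
proof -
  have "0 \<le> (d - 2 * c)\<^sup>2 / 2" by simp
  then show ?thesis by (simp add: power2_eq_square algebra_simps)
qed

text \<open>The deterministic heart of the argument, for a matrix \<open>D = U - N\<close> with \<open>U\<close> of rank at most \<open>k\<close>. The vectors
  \<open>e i\<close>, \<open>i < J'\<close>, span the columns of \<open>N\<close> and \<open>q j\<close>, \<open>j < r\<close>, its rows; \<open>e i\<close>, \<open>i < J''\<close>, span the columns of both
  \<open>U\<close> and \<open>N\<close>, and \<open>w\<close> those of \<open>U\<close>. In these coordinates \<open>D\<close> splits orthogonally into three blocks:
  \<open>{..<J'} \<times> {..<r}\<close> in the basis \<open>e\<close>, a space of matrices that does not depend on \<open>U\<close>; \<open>{J'..<J''} \<times> {..<r}\<close> in the basis \<open>e\<close>; and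
  \<open>{..<d} \<times> {r..<n'}\<close> in the basis \<open>w\<close>. The last two blocks are free of \<open>N\<close>, so they have rank at most \<open>k\<close> and not
  just \<open>k\<close> plus the rank of \<open>N\<close>. This avoids cross terms between the rank of one matrix and the support of the
  other, which no sum of the two penalties would control.\<close>

lemma low_rank_perturbation_bound:
  fixes G D U N :: "'s \<times> 't \<Rightarrow> real" and r n' J' J'' d k :: nat
  assumes e: "onf S {..<J''} e" and J: "J' \<le> J''" and w: "onf S {..<d} w"
    and q: "onf T {..<n'} q" "\<And>x. in_span T {..<n'} q x" and r: "r \<le> n'"
    and N0: "\<And>j s. r \<le> j \<Longrightarrow> j < n' \<Longrightarrow> s \<in> S \<Longrightarrow> mv T N (q j) s = 0"
    and N1: "\<And>j. j < r \<Longrightarrow> in_span S {..<J'} e (mv T N (q j))"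
    and U: "\<And>s t. s \<in> S \<Longrightarrow> t \<in> T \<Longrightarrow> U (s, t) = (\<Sum>l<k. a l s * b l t)"
    and ae: "\<And>l. l < k \<Longrightarrow> in_span S {..<J''} e (a l)"
    and aw: "\<And>l. l < k \<Longrightarrow> in_span S {..<d} w (a l)"
    and D: "D = (\<lambda>x. U x - N x)"
    and s1: "0 \<le> s1" "\<And>v. (\<Sum>i\<in>{J'..<J''}. (ip {..<r} (\<lambda>j. ip S (e i) (mv T G (q j))) v)\<^sup>2) \<le> s1 * ip {..<r} v v"
    and s2: "0 \<le> s2" "\<And>v. (\<Sum>i\<in>{..<d}. (ip {r..<n'} (\<lambda>j. ip S (w i) (mv T G (q j))) v)\<^sup>2) \<le> s2 * ip {r..<n'} v v"
  shows "2 * ip (S \<times> T) G D \<le> ip (S \<times> T) D D / 2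
    + 2 * (\<Sum>i<J'. \<Sum>j<r. (ip S (e i) (mv T G (q j)))\<^sup>2) + 2 * (real k * (s1 + s2))"
proof -
  define c where "c = (\<lambda>i j. ip S (e i) (mv T G (q j)))"
  define c' where "c' = (\<lambda>i j. ip S (w i) (mv T G (q j)))"
  define \<delta> where "\<delta> = (\<lambda>i j. ip S (e i) (mv T D (q j)))"
  define \<delta>' where "\<delta>' = (\<lambda>i j. ip S (w i) (mv T D (q j)))"
  have mvD: "mv T D y s = mv T U y s - mv T N y s" for y s
    unfolding D mv_def ip_diff_left ..
  have Umv: "mv T U y s = (\<Sum>l<k. ip T (b l) y * a l s)" if "s \<in> S" for y s
    by (rule mv_lincomb_tens) (rule U[OF that])
  have Ue: "in_span S {..<J''} e (mv T U y)" for y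
    by (rule in_span_cong[OF in_span_sum[of "{..<k}" S "{..<J''}" e a "\<lambda>l. ip T (b l) y"]])
      (use ae Umv in auto)
  have Uw: "in_span S {..<d} w (mv T U y)" for y
    by (rule in_span_cong[OF in_span_sum[of "{..<k}" S "{..<d}" w a "\<lambda>l. ip T (b l) y"]])
      (use aw Umv in auto)
  have De: "in_span S {..<J''} e (mv T D (q j))" if "j < r" for j
    by (rule in_span_cong[OF in_span_diff[OF Ue in_span_mono[OF N1[OF that]]]])
      (use J mvD in auto)
  have Dw: "in_span S {..<d} w (mv T D (q j))" if "r \<le> j" "j < n'" for j
    by (rule in_span_cong[OF Uw]) (use N0[OF that] mvD in auto)
  have split: "ip (S \<times> T) H D = (\<Sum>j<r. \<Sum>i<J'. ip S (e i) (mv T H (q j)) * \<delta> i j)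
      + (\<Sum>i\<in>{J'..<J''}. ip {..<r} (\<lambda>j. ip S (e i) (mv T H (q j))) (\<delta> i))
      + (\<Sum>i<d. ip {r..<n'} (\<lambda>j. ip S (w i) (mv T H (q j))) (\<delta>' i))" for H
  proof -
    have "ip (S \<times> T) H D = (\<Sum>j<n'. ip S (mv T H (q j)) (mv T D (q j)))"
      by (rule ip_mv[OF q(1) _ q(2)]) simp
    also have "\<dots> = (\<Sum>j<r. ip S (mv T H (q j)) (mv T D (q j))) + (\<Sum>j\<in>{r..<n'}. ip S (mv T H (q j)) (mv T D (q j)))"
      using r by (simp add: lessThan_atLeast0 sum.atLeastLessThan_concat)
    also have "(\<Sum>j\<in>{r..<n'}. ip S (mv T H (q j)) (mv T D (q j)))
       = (\<Sum>j\<in>{r..<n'}. \<Sum>i<d. ip S (w i) (mv T H (q j)) * \<delta>' i j)"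
      using parseval[OF w _ Dw] by (intro sum.cong) (auto simp: \<delta>'_def ip_commute[of S "w _"])
    also have "\<dots> = (\<Sum>i<d. ip {r..<n'} (\<lambda>j. ip S (w i) (mv T H (q j))) (\<delta>' i))"
      unfolding ip_def[of "{r..<n'}"] by (rule sum.swap)
    also have "(\<Sum>j<r. ip S (mv T H (q j)) (mv T D (q j))) = (\<Sum>j<r. \<Sum>i<J''. ip S (e i) (mv T H (q j)) * \<delta> i j)"
      using parseval[OF e _ De] by (intro sum.cong) (auto simp: \<delta>_def ip_commute[of S "e _"])
    also have "\<dots> = (\<Sum>j<r. (\<Sum>i<J'. ip S (e i) (mv T H (q j)) * \<delta> i j)
        + (\<Sum>i\<in>{J'..<J''}. ip S (e i) (mv T H (q j)) * \<delta> i j))"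
      using J by (simp add: lessThan_atLeast0 sum.atLeastLessThan_concat)
    also have "\<dots> = (\<Sum>j<r. \<Sum>i<J'. ip S (e i) (mv T H (q j)) * \<delta> i j)
        + (\<Sum>i\<in>{J'..<J''}. ip {..<r} (\<lambda>j. ip S (e i) (mv T H (q j))) (\<delta> i))"
      unfolding ip_def[of "{..<r}"] sum.distrib by (subst (2) sum.swap) simp
    finally show ?thesis .
  qed
  have "2 * (\<Sum>j<r. \<Sum>i<J'. c i j * \<delta> i j) \<le> (\<Sum>j<r. \<Sum>i<J'. (\<delta> i j)\<^sup>2 / 2 + 2 * (c i j)\<^sup>2)"
    unfolding sum_distrib_left by (intro sum_mono young2)
  also have "\<dots> = (\<Sum>j<r. \<Sum>i<J'. (\<delta> i j)\<^sup>2) / 2 + 2 * (\<Sum>i<J'. \<Sum>j<r. (c i j)\<^sup>2)"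
    by (simp add: sum.distrib sum_distrib_left sum_divide_distrib sum.swap[of _ "{..<J'}" "{..<r}"])
  finally have b1: "2 * (\<Sum>j<r. \<Sum>i<J'. c i j * \<delta> i j)
    \<le> (\<Sum>j<r. \<Sum>i<J'. (\<delta> i j)\<^sup>2) / 2 + 2 * (\<Sum>i<J'. \<Sum>j<r. (c i j)\<^sup>2)" .
  have b2: "2 * (\<Sum>i\<in>{J'..<J''}. ip {..<r} (c i) (\<delta> i))
     \<le> (\<Sum>i\<in>{J'..<J''}. ip {..<r} (\<delta> i) (\<delta> i)) / 2 + 2 * (real k * s1)"
  proof (rule low_rank_young[where \<alpha> = "\<lambda>l i. ip S (e i) (a l)" and \<beta> = "\<lambda>l j. ip T (b l) (q j)"])
    fix i j assume i: "i \<in> {J'..<J''}" and j: "j \<in> {..<r}"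
    have "ip S (mv T N (q j)) (e i) = 0"
      by (rule in_span_orthogonal[OF e _ _ N1]) (use i j J in auto)
    then have "\<delta> i j = ip S (e i) (mv T U (q j))"
      unfolding \<delta>_def mvD[abs_def] ip_diff_right by (simp add: ip_commute[of S "e i"])
    also have "\<dots> = ip S (e i) (\<lambda>s. \<Sum>l<k. ip T (b l) (q j) * a l s)"
      by (rule ip_cong) (use Umv in auto)
    finally show "\<delta> i j = (\<Sum>l<k. ip S (e i) (a l) * ip T (b l) (q j))"
      unfolding ip_sum_right by (simp add: mult.commute)
  qed (use s1 c_def in auto)
  have b3: "2 * (\<Sum>i<d. ip {r..<n'} (c' i) (\<delta>' i))
     \<le> (\<Sum>i<d. ip {r..<n'} (\<delta>' i) (\<delta>' i)) / 2 + 2 * (real k * s2)"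
  proof (rule low_rank_young[where \<alpha> = "\<lambda>l i. ip S (w i) (a l)" and \<beta> = "\<lambda>l j. ip T (b l) (q j)"])
    fix i j assume i: "i \<in> {..<d}" and j: "j \<in> {r..<n'}"
    have "\<delta>' i j = ip S (w i) (\<lambda>s. \<Sum>l<k. ip T (b l) (q j) * a l s)"
      unfolding \<delta>'_def by (rule ip_cong) (use Umv mvD N0 j in auto)
    then show "\<delta>' i j = (\<Sum>l<k. ip S (w i) (a l) * ip T (b l) (q j))"
      unfolding ip_sum_right by (simp add: mult.commute)
  qed (use s2 c'_def in auto)
  have DD: "ip (S \<times> T) D D = (\<Sum>j<r. \<Sum>i<J'. (\<delta> i j)\<^sup>2) + (\<Sum>i\<in>{J'..<J''}. ip {..<r} (\<delta> i) (\<delta> i))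
     + (\<Sum>i<d. ip {r..<n'} (\<delta>' i) (\<delta>' i))"
  proof -
    have "\<And>i j. ip S (e i) (mv T D (q j)) = \<delta> i j" "\<And>i j. ip S (w i) (mv T D (q j)) = \<delta>' i j"
      by (simp_all add: \<delta>_def \<delta>'_def)
    then show ?thesis using split[of D] by (simp add: power2_eq_square)
  qed
  have "ip (S \<times> T) G D = (\<Sum>j<r. \<Sum>i<J'. c i j * \<delta> i j) + (\<Sum>i\<in>{J'..<J''}. ip {..<r} (c i) (\<delta> i))
      + (\<Sum>i<d. ip {r..<n'} (c' i) (\<delta>' i))"
  proof -
    have "\<And>i j. ip S (e i) (mv T G (q j)) = c i j" "\<And>i j. ip S (w i) (mv T G (q j)) = c' i j"
      by (simp_all add: c_def c'_def)
    then show ?thesis using split[of G] by simp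
  qed
  moreover have "(\<Sum>i<J'. \<Sum>j<r. (ip S (e i) (mv T G (q j)))\<^sup>2) = (\<Sum>i<J'. \<Sum>j<r. (c i j)\<^sup>2)"
    by (simp add: c_def)
  moreover have "2 * g \<le> (X + Y + Z) / 2 + 2 * F + 2 * (real k * (s1 + s2))"
    if "g = x + y + z" "2 * x \<le> X / 2 + 2 * F" "2 * y \<le> Y / 2 + 2 * (real k * s1)"
      "2 * z \<le> Z / 2 + 2 * (real k * s2)" for g x y z X Y Z F
    using that by (simp add: field_simps)
  ultimately show ?thesis using b1 b2 b3 unfolding DD by simp
qed

section \<open>Uniform noise bound over supports\<close>

lemma mv_lincomb_right: "mv T G (\<lambda>t. \<Sum>j\<in>K. y j * q j t) s = (\<Sum>j\<in>K. y j * mv T G (q j) s)"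
  unfolding mv_def by (rule ip_sum_right)

text \<open>The stochastic bound for a fixed candidate support \<open>J\<close> of the estimator and a fixed comparison matrix \<open>N\<close>.
  The columns of the design are \<open>x j\<close>. The excess of the noise over the threshold \<open>\<theta>\<close> is absorbed in a single random
  variable \<open>R\<close> valid for all matrices with columns in the span of \<open>x j\<close>, \<open>j \<in> J\<close>. The two nets live in
  dimensions \<open>r\<close> and \<open>n' - r\<close>, so together they cost only \<open>15 ^ n'\<close>.\<close>

lemma selection_noise_bound:
  fixes E :: "'s \<times> 't \<Rightarrow> 'w \<Rightarrow> real" and x :: "nat \<Rightarrow> 's \<Rightarrow> real"
  assumes gv: "gaussian_vector M (S \<times> T) \<sigma> E" and S: "finite S" and T: "finite T"
    and e0: "onf S {..<J0::nat} e0"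
    and q: "onf T {..<n'::nat} q" "\<And>y. in_span T {..<n'} q y" and r: "r \<le> n'"
    and N0: "\<And>j s. r \<le> j \<Longrightarrow> j < n' \<Longrightarrow> s \<in> S \<Longrightarrow> mv T N (q j) s = 0"
    and N1: "\<And>j. j < r \<Longrightarrow> in_span S {..<J0} e0 (mv T N (q j))"
    and J: "finite J"
  shows "\<exists>R. R \<in> borel_measurable M \<and> (\<forall>\<omega>. 0 \<le> R \<omega>) \<and>
    (\<integral>\<^sup>+\<omega>. ennreal (R \<omega>) \<partial>M) \<le> ennreal (4 * \<sigma>\<^sup>2 * (15 ^ n' * 3 ^ card J * exp (- \<theta> / (4 * \<sigma>\<^sup>2)))) \<and>
    (\<forall>\<omega> k a b U. (\<forall>s\<in>S. \<forall>t\<in>T. U (s, t) = (\<Sum>l<k. a l s * b l t)) \<longrightarrow> (\<forall>l<k. in_span S J x (a l)) \<longrightarrow>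
      2 * ip (S \<times> T) (\<lambda>i. E i \<omega>) (\<lambda>i. U i - N i) \<le> ip (S \<times> T) (\<lambda>i. U i - N i) (\<lambda>i. U i - N i) / 2
        + 2 * (\<Sum>i<J0. \<Sum>j<r. (ip (S \<times> T) (tens (e0 i) (q j)) (\<lambda>i. E i \<omega>))\<^sup>2)
        + 2 * (real k * (\<theta> + R \<omega>)))"
proof -
  interpret gaussian_vector M "S \<times> T" \<sigma> E by (rule gv)
  have cJ: "card (x ` J) \<le> card J" using J by (rule card_image_le)
  obtain e J1 where J1: "J0 \<le> J1" "J1 \<le> J0 + card (x ` J)" and ee: "\<forall>i<J0. e i = e0 i"
    and e: "onf S {..<J1} e" and esp: "\<forall>c\<in>x ` J. in_span S {..<J1} e c"
    using gram_schmidt_extend[OF S finite_imageI[OF J] e0, of x] by blast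
  have "onf S {..<0::nat} (\<lambda>_ _. 0)" by (simp add: onf_def)
  from gram_schmidt_extend[OF S finite_imageI[OF J] this, of x]
  obtain w d where d: "d \<le> card (x ` J)" and w: "onf S {..<d} w"
    and wsp: "\<forall>c\<in>x ` J. in_span S {..<d} w c" by auto
  obtain N1' where N1': "finite N1'" "card N1' \<le> 15 ^ card {..<r}" "\<forall>z\<in>N1'. ip {..<r} z z \<le> 1"
    and net1: "\<And>(I::nat set) g. finite I \<Longrightarrow> \<exists>z\<in>N1'. \<forall>v. (\<Sum>i\<in>I. (ip {..<r} (g i) v)\<^sup>2)
        \<le> 4 / 3 * (\<Sum>i\<in>I. (ip {..<r} (g i) z)\<^sup>2) * ip {..<r} v v"
    using operator_norm_net[of "{..<r}", where 'a = nat] by blast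
  obtain N2' where N2': "finite N2'" "card N2' \<le> 15 ^ card {r..<n'}" "\<forall>z\<in>N2'. ip {r..<n'} z z \<le> 1"
    and net2: "\<And>(I::nat set) g. finite I \<Longrightarrow> \<exists>z\<in>N2'. \<forall>v. (\<Sum>i\<in>I. (ip {r..<n'} (g i) v)\<^sup>2)
        \<le> 4 / 3 * (\<Sum>i\<in>I. (ip {r..<n'} (g i) z)\<^sup>2) * ip {r..<n'} v v"
    using operator_norm_net[of "{r..<n'}", where 'a = nat] by blast
  define yq where "yq = (\<lambda>y t. \<Sum>j<r. y j * q j t)"
  define zq where "zq = (\<lambda>z t. \<Sum>j\<in>{r..<n'}. z j * q j t)"
  \<comment> \<open>The directions probed by a pair of net elements: \<open>Inl\<close> for the block in the basis \<open>e\<close>, \<open>Inr\<close> for the block in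
      the basis \<open>w\<close>. They are orthogonal because \<open>yq y\<close> and \<open>zq z\<close> use disjoint parts of the basis \<open>q\<close>.\<close>
  define f where "f = (\<lambda>y z i. case i of Inl i \<Rightarrow> tens (e i) (yq y) | Inr i \<Rightarrow> tens (w i) (zq z))"
  define I where "I = {J0..<J1} <+> {..<d}"
  define Q where "Q = (\<lambda>y z \<omega>. \<Sum>i\<in>I. (coord (f y z i) \<omega>)\<^sup>2)"
  define R where "R = (\<lambda>\<omega>. \<Sum>y\<in>N1'. \<Sum>z\<in>N2'. 4 * \<sigma>\<^sup>2 * exp (Q y z \<omega> / (3 * \<sigma>\<^sup>2) - \<theta> / (4 * \<sigma>\<^sup>2)))"
  have [measurable]: "Q y z \<in> borel_measurable M" for y z unfolding Q_def by measurable
  have finI: "finite I" unfolding I_def by simp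
  have cardI: "card I \<le> 2 * card J" unfolding I_def using J1 d cJ by (simp add: card_Plus)
  have \<sigma>: "\<sigma>\<^sup>2 > 0" using sigma_pos by simp
  have yq: "ip T (yq y) (yq y) = ip {..<r} y y" for y
  proof -
    have "ip T (yq y) (yq y) = (\<Sum>j<r. y j * ip T (yq y) (q j))"
      by (subst (2) yq_def) (rule ip_sum_right)
    also have "\<dots> = (\<Sum>j<r. y j * y j)"
    proof (intro sum.cong refl)
      fix j assume j: "j \<in> {..<r}"
      have "onf T {..<r} q" using q(1) r unfolding onf_def by auto
      then show "y j * ip T (yq y) (q j) = y j * y j"
        unfolding yq_def using ip_lincomb_onf[of T "{..<r}" q j y] j by simp
    qed
    finally show ?thesis by (simp add: ip_def)
  qed
  have zq: "ip T (zq y) (zq y) = ip {r..<n'} y y" for y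
  proof -
    have "ip T (zq y) (zq y) = (\<Sum>j\<in>{r..<n'}. y j * ip T (zq y) (q j))"
      by (subst (2) zq_def) (rule ip_sum_right)
    also have "\<dots> = (\<Sum>j\<in>{r..<n'}. y j * y j)"
    proof (intro sum.cong refl)
      fix j assume j: "j \<in> {r..<n'}"
      have "onf T {r..<n'} q" using q(1) r unfolding onf_def by auto
      then show "y j * ip T (zq y) (q j) = y j * y j"
        unfolding zq_def using ip_lincomb_onf[of T "{r..<n'}" q j y] j by simp
    qed
    finally show ?thesis by (simp add: ip_def)
  qed
  have yz: "ip T (yq y) (zq z) = 0" for y z
  proof -
    have "in_span T {..<r} q (yq y)" unfolding in_span_def yq_def by blast
    then have "ip T (yq y) (q j) = 0" if "j \<in> {r..<n'}" for j
      using in_span_orthogonal[OF q(1) _ _ , of "{..<r}" "yq y" j] r that by auto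
    then show ?thesis unfolding zq_def ip_sum_right by simp
  qed
  have orth: "ip (S \<times> T) (f y z i) (f y z j) = 0" if "i \<in> I" "j \<in> I" "i \<noteq> j" for y z i j
    using that onfD[OF e] onfD[OF w] yz[of y z] ip_commute[of T "zq z" "yq y"]
    by (auto simp: f_def I_def ip_tens split: if_splits)
  have unit: "ip (S \<times> T) (f y z i) (f y z i) \<le> 1" if "i \<in> I" "y \<in> N1'" "z \<in> N2'" for y z i
    using that onfD[OF e] onfD[OF w] yq[of y] zq[of z] N1'(3) N2'(3)
    by (auto simp: f_def I_def ip_tens)
  have 1: "R \<in> borel_measurable M" unfolding R_def by measurable
  have 2: "0 \<le> R \<omega>" for \<omega> unfolding R_def by (intro sum_nonneg) simp
  have summand: "(\<integral>\<^sup>+\<omega>. ennreal (4 * \<sigma>\<^sup>2 * exp (Q y z \<omega> / (3 * \<sigma>\<^sup>2) - \<theta> / (4 * \<sigma>\<^sup>2))) \<partial>M)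
     \<le> ennreal (4 * \<sigma>\<^sup>2 * (3 ^ card J * exp (- \<theta> / (4 * \<sigma>\<^sup>2))))" if yz: "y \<in> N1'" "z \<in> N2'" for y z
  proof -
    have "(\<integral>\<^sup>+\<omega>. ennreal (4 * \<sigma>\<^sup>2 * exp (Q y z \<omega> / (3 * \<sigma>\<^sup>2) - \<theta> / (4 * \<sigma>\<^sup>2))) \<partial>M)
      = (\<integral>\<^sup>+\<omega>. ennreal (4 * \<sigma>\<^sup>2 * exp (- \<theta> / (4 * \<sigma>\<^sup>2))) * ennreal (exp (Q y z \<omega> / (3 * \<sigma>\<^sup>2) + coord (\<lambda>_. 0) \<omega>)) \<partial>M)"
      by (simp add: ennreal_mult'[symmetric] coord_def ip_def exp_diff exp_minus field_simps)
    also have "\<dots> = ennreal (4 * \<sigma>\<^sup>2 * exp (- \<theta> / (4 * \<sigma>\<^sup>2))) * (\<integral>\<^sup>+\<omega>. ennreal (exp (Q y z \<omega> / (3 * \<sigma>\<^sup>2) + coord (\<lambda>_. 0) \<omega>)) \<partial>M)"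
      by (rule nn_integral_cmult) measurable
    also have "\<dots> \<le> ennreal (4 * \<sigma>\<^sup>2 * exp (- \<theta> / (4 * \<sigma>\<^sup>2))) * ennreal (sqrt 3 ^ card I * exp (\<sigma>\<^sup>2 / 2 * ip (S \<times> T) (\<lambda>_. 0) (\<lambda>_. 0)))"
      unfolding Q_def
    proof (intro mult_left_mono nn_integral_exp_sum_squares finI orth unit)
      show "ip (S \<times> T) (f y z i) (\<lambda>_. 0) = 0" for i by (simp add: ip_def)
    qed (use yz in auto)
    also have "\<dots> \<le> ennreal (4 * \<sigma>\<^sup>2 * exp (- \<theta> / (4 * \<sigma>\<^sup>2))) * ennreal (3 ^ card J)"
    proof (intro mult_left_mono ennreal_leI)
      have "sqrt 3 ^ card I \<le> sqrt 3 ^ (2 * card J)" using cardI by (intro power_increasing) auto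
      also have "\<dots> = 3 ^ card J" by (simp add: power_mult)
      finally show "sqrt 3 ^ card I * exp (\<sigma>\<^sup>2 / 2 * ip (S \<times> T) (\<lambda>_. 0) (\<lambda>_. 0)) \<le> 3 ^ card J"
        by (simp add: ip_def)
    qed simp
    finally show ?thesis by (simp add: ennreal_mult'[symmetric] mult_ac)
  qed
  have 3: "(\<integral>\<^sup>+\<omega>. ennreal (R \<omega>) \<partial>M) \<le> ennreal (4 * \<sigma>\<^sup>2 * (15 ^ n' * 3 ^ card J * exp (- \<theta> / (4 * \<sigma>\<^sup>2))))"
  proof -
    let ?B = "4 * \<sigma>\<^sup>2 * (3 ^ card J * exp (- \<theta> / (4 * \<sigma>\<^sup>2)))"
    have "(\<integral>\<^sup>+\<omega>. ennreal (R \<omega>) \<partial>M)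
      = (\<integral>\<^sup>+\<omega>. (\<Sum>y\<in>N1'. \<Sum>z\<in>N2'. ennreal (4 * \<sigma>\<^sup>2 * exp (Q y z \<omega> / (3 * \<sigma>\<^sup>2) - \<theta> / (4 * \<sigma>\<^sup>2)))) \<partial>M)"
      unfolding R_def by (simp add: sum_ennreal sum_nonneg)
    also have "\<dots> = (\<Sum>y\<in>N1'. \<Sum>z\<in>N2'. \<integral>\<^sup>+\<omega>. ennreal (4 * \<sigma>\<^sup>2 * exp (Q y z \<omega> / (3 * \<sigma>\<^sup>2) - \<theta> / (4 * \<sigma>\<^sup>2))) \<partial>M)"
      by (simp add: nn_integral_sum del: sum_ennreal)
    also have "\<dots> \<le> (\<Sum>y\<in>N1'. \<Sum>z\<in>N2'. ennreal ?B)" by (intro sum_mono summand)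
    also have "\<dots> = ennreal (real (card N1') * (real (card N2') * ?B))"
      by (simp add: ennreal_mult ennreal_of_nat_eq_real_of_nat)
    also have "\<dots> \<le> ennreal (15 ^ r * (15 ^ (n' - r) * ?B))"
    proof (intro ennreal_leI mult_mono)
      show "real (card N1') \<le> 15 ^ r" 
        using of_nat_mono[OF N1'(2), where 'a = real] by simp
      show "real (card N2') \<le> 15 ^ (n' - r)" 
        using of_nat_mono[OF N2'(2), where 'a = real] by simp
    qed auto
    also have "15 ^ r * (15 ^ (n' - r) * ?B) = 4 * \<sigma>\<^sup>2 * (15 ^ n' * 3 ^ card J * exp (- \<theta> / (4 * \<sigma>\<^sup>2)))"
    proof -
      have "(15::real) ^ r * 15 ^ (n' - r) = 15 ^ n'" using r by (simp add: power_add[symmetric])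
      then show ?thesis by (simp add: mult_ac)
    qed
    finally show ?thesis .
  qed
  have 4: "2 * ip (S \<times> T) (\<lambda>i. E i \<omega>) (\<lambda>i. U i - N i) \<le> ip (S \<times> T) (\<lambda>i. U i - N i) (\<lambda>i. U i - N i) / 2
        + 2 * (\<Sum>i<J0. \<Sum>j<r. (ip (S \<times> T) (tens (e0 i) (q j)) (\<lambda>i. E i \<omega>))\<^sup>2)
        + 2 * (real k * (\<theta> + R \<omega>))"
    if U: "\<forall>s\<in>S. \<forall>t\<in>T. U (s, t) = (\<Sum>l<k. a l s * b l t)" and a: "\<forall>l<k. in_span S J x (a l)"
    for \<omega> k a b U
  proof -
    let ?G = "\<lambda>i. E i \<omega>"
    let ?c = "\<lambda>i j. ip S (e i) (mv T ?G (q j))" and ?c' = "\<lambda>i j. ip S (w i) (mv T ?G (q j))"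
    obtain y where y: "y \<in> N1'" "\<And>v. (\<Sum>i\<in>{J0..<J1}. (ip {..<r} (?c i) v)\<^sup>2)
        \<le> 4 / 3 * (\<Sum>i\<in>{J0..<J1}. (ip {..<r} (?c i) y)\<^sup>2) * ip {..<r} v v"
      using net1[of "{J0..<J1}" ?c] by auto
    obtain z where z: "z \<in> N2'" "\<And>v. (\<Sum>i\<in>{..<d}. (ip {r..<n'} (?c' i) v)\<^sup>2)
        \<le> 4 / 3 * (\<Sum>i\<in>{..<d}. (ip {r..<n'} (?c' i) z)\<^sup>2) * ip {r..<n'} v v"
      using net2[of "{..<d}" ?c'] by auto
    define s1 where "s1 = 4 / 3 * (\<Sum>i\<in>{J0..<J1}. (ip {..<r} (?c i) y)\<^sup>2)"
    define s2 where "s2 = 4 / 3 * (\<Sum>i\<in>{..<d}. (ip {r..<n'} (?c' i) z)\<^sup>2)"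
    have N1e: "in_span S {..<J0} e (mv T N (q j))" if "j < r" for j
      by (rule in_span_cong[OF N1[OF that]]) (use ee in auto)
    have "2 * ip (S \<times> T) ?G (\<lambda>i. U i - N i) \<le> ip (S \<times> T) (\<lambda>i. U i - N i) (\<lambda>i. U i - N i) / 2
      + 2 * (\<Sum>i<J0. \<Sum>j<r. (ip S (e i) (mv T ?G (q j)))\<^sup>2) + 2 * (real k * (s1 + s2))"
    proof (rule low_rank_perturbation_bound[OF e J1(1) w q r N0 N1e])
      show "\<And>l. l < k \<Longrightarrow> in_span S {..<J1} e (a l)" using in_span_trans[of S J x] a esp by blast
      show "\<And>l. l < k \<Longrightarrow> in_span S {..<d} w (a l)" using in_span_trans[of S J x] a wsp by blast
      show "\<And>v. (\<Sum>i\<in>{J0..<J1}. (ip {..<r} (?c i) v)\<^sup>2) \<le> s1 * ip {..<r} v v" using y(2) unfolding s1_def .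
      show "\<And>v. (\<Sum>i\<in>{..<d}. (ip {r..<n'} (?c' i) v)\<^sup>2) \<le> s2 * ip {r..<n'} v v" using z(2) unfolding s2_def .
    qed (use U in \<open>auto simp: s1_def s2_def sum_nonneg\<close>)
    moreover have s12: "s1 + s2 = 4 / 3 * Q y z \<omega>"
    proof -
      have "coord (f y z (Inl i)) \<omega> = ip {..<r} (?c i) y" for i
      proof -
        have "coord (f y z (Inl i)) \<omega> = ip S (e i) (\<lambda>s. \<Sum>j<r. y j * mv T ?G (q j) s)"
          unfolding coord_def f_def yq_def by (simp add: ip_tens_mv mv_lincomb_right[abs_def])
        also have "\<dots> = (\<Sum>j<r. y j * ?c i j)" by (rule ip_sum_right)
        finally show ?thesis unfolding ip_def[of "{..<r}"] by (simp add: mult.commute)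
      qed
      moreover have "coord (f y z (Inr i)) \<omega> = ip {r..<n'} (?c' i) z" for i
      proof -
        have "coord (f y z (Inr i)) \<omega> = ip S (w i) (\<lambda>s. \<Sum>j\<in>{r..<n'}. z j * mv T ?G (q j) s)"
          unfolding coord_def f_def zq_def by (simp add: ip_tens_mv mv_lincomb_right[abs_def])
        also have "\<dots> = (\<Sum>j\<in>{r..<n'}. z j * ?c' i j)" by (rule ip_sum_right)
        finally show ?thesis unfolding ip_def[of "{r..<n'}"] by (simp add: mult.commute)
      qed
      ultimately show ?thesis unfolding s1_def s2_def Q_def I_def
        by (simp add: sum.Plus comp_def algebra_simps)
    qed
    moreover have "4 / 3 * Q y z \<omega> \<le> \<theta> + R \<omega>"
    proof -
      let ?u = "Q y z \<omega> / (3 * \<sigma>\<^sup>2) - \<theta> / (4 * \<sigma>\<^sup>2)"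
      \<comment> \<open>The positive part of the excess is bounded by an exponential with exponent \<open>1 / (4 \<sigma>\<^sup>2)\<close>, which turns the
          factor \<open>4/3\<close> of the net into the \<open>1 / (3 \<sigma>\<^sup>2)\<close> of the chi-square bound.\<close>
      have "?u \<le> exp ?u" using exp_ge_add_one_self[of ?u] by linarith
      then have "4 * \<sigma>\<^sup>2 * ?u \<le> 4 * \<sigma>\<^sup>2 * exp ?u" using \<sigma> by (intro mult_left_mono) auto
      moreover have "4 * \<sigma>\<^sup>2 * ?u = 4 / 3 * Q y z \<omega> - \<theta>" using sigma_pos by (simp add: field_simps)
      moreover have "4 * \<sigma>\<^sup>2 * exp ?u \<le> R \<omega>"
      proof -
        have "4 * \<sigma>\<^sup>2 * exp ?u \<le> (\<Sum>z\<in>N2'. 4 * \<sigma>\<^sup>2 * exp (Q y z \<omega> / (3 * \<sigma>\<^sup>2) - \<theta> / (4 * \<sigma>\<^sup>2)))"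
          using z(1) N2'(1) by (intro member_le_sum[of z N2' "\<lambda>z. 4 * \<sigma>\<^sup>2 * exp (Q y z \<omega> / (3 * \<sigma>\<^sup>2) - \<theta> / (4 * \<sigma>\<^sup>2))"]) auto
        also have "\<dots> \<le> R \<omega>" unfolding R_def
          using y(1) N1'(1) by (intro member_le_sum[of y N1' "\<lambda>y. \<Sum>z\<in>N2'. 4 * \<sigma>\<^sup>2 * exp (Q y z \<omega> / (3 * \<sigma>\<^sup>2) - \<theta> / (4 * \<sigma>\<^sup>2))"]) (auto intro: sum_nonneg)
        finally show ?thesis .
      qed
      ultimately show ?thesis by linarith
    qed
    then have "2 * (real k * (s1 + s2)) \<le> 2 * (real k * (\<theta> + R \<omega>))"
      unfolding s12 by (intro mult_left_mono) auto
    moreover have "(\<Sum>i<J0. \<Sum>j<r. (ip S (e i) (mv T ?G (q j)))\<^sup>2)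
       = (\<Sum>i<J0. \<Sum>j<r. (ip (S \<times> T) (tens (e0 i) (q j)) ?G)\<^sup>2)"
      using ee by (simp add: ip_tens_mv)
    ultimately show ?thesis by linarith
  qed
  from 1 2 3 4 show ?thesis by (intro exI[of _ R]) blast
qed

lemma power_div_fact_le_exp:
  assumes "0 \<le> x"
  shows "x ^ j / fact j \<le> exp (x::real)"
proof -
  have "(\<Sum>i\<in>{j}. x ^ i /\<^sub>R fact i) \<le> (\<Sum>i. x ^ i /\<^sub>R fact i)"
    using exp_converges[of x] assms by (intro sum_le_suminf) (auto simp: sums_iff)
  then show ?thesis using exp_converges[of x] by (simp add: sums_iff divide_inverse mult.commute)
qed

lemma binomial_le_exp_pow:
  assumes "1 \<le> j" "j \<le> p"
  shows "real (p choose j) \<le> exp (real j * ln (exp 1 * real p / real j))"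
proof -
  have j: "real j > 0" and p: "real p > 0" using assms by auto
  have "real (p choose j) * fact j \<le> real p ^ j"
    using binomial_fact_pow[of p j] by (metis of_nat_fact of_nat_le_iff of_nat_mult of_nat_power)
  then have "real (p choose j) \<le> real p ^ j / fact j" by (simp add: field_simps)
  also have "\<dots> = (real p / real j) ^ j * (real j ^ j / fact j)" using j by (simp add: power_divide)
  also have "\<dots> \<le> (real p / real j) ^ j * exp (real j)"
    using power_div_fact_le_exp[of "real j" j] by (intro mult_left_mono) auto
  also have "\<dots> = (real p / real j) ^ j * exp 1 ^ j" by (simp add: exp_of_nat_mult[symmetric])
  also have "\<dots> = (exp 1 * real p / real j) ^ j" by (simp add: power_mult_distrib power_divide)
  also have "\<dots> = exp (ln (exp 1 * real p / real j)) ^ j" using j p by simp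
  also have "\<dots> = exp (real j * ln (exp 1 * real p / real j))" by (rule exp_of_nat_mult[symmetric])
  finally show ?thesis .
qed

text \<open>For \<open>j = 0\<close> the quotient is a division by zero, but its logarithm is multiplied by \<open>0\<close>.\<close>

lemma support_log_nonneg:
  assumes "j \<le> p"
  shows "0 \<le> real j * ln (exp 1 * real p / real j)"
proof (cases "j = 0")
  case False
  have "1 * real j \<le> exp 1 * real p"
    using assms exp_ge_add_one_self[of "1::real"] by (intro mult_mono) auto
  then have "1 \<le> exp 1 * real p / real j" using False by (simp add: le_divide_eq)
  then show ?thesis by simp
qed simp

text \<open>Summed over all candidate supports, the exponential excess bounds stay below a constant: the term \<open>2 n\<close> of the
  penalty pays for the nets, the term \<open>ln (2 e) \<bar>J\<bar>\<close> for the chi-square factor \<open>3 ^ \<bar>J\<bar>\<close> and for a geometric series, and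
  \<open>\<bar>J\<bar> ln (e p / \<bar>J\<bar>)\<close> for the number of supports of a given size.\<close>

lemma sum_over_supports_le:
  fixes n n' p :: nat
  assumes n': "n' \<le> n"
  shows "(\<Sum>J\<in>Pow {..<p}. 15 ^ n' * 3 ^ card J *
    exp (- (3 / 2) * (2 * real n + ln (2 * exp 1) * real (card J) + real (card J) * ln (exp 1 * real p / real (card J))))) \<le> 2"
proof -
  define h where "h = (\<lambda>j::nat. 15 ^ n' * 3 ^ j *
    exp (- (3 / 2) * (2 * real n + ln (2 * exp 1) * real j + real j * ln (exp 1 * real p / real j))))"
  \<comment> \<open>The numerical bounds \<open>15 \<le> exp 3\<close> and \<open>3 \<le> exp (3/2)\<close> come from powers of \<open>1 + x \<le> exp x\<close>.\<close>
  define v :: real where "v = exp (1 / 5)"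
  have v: "6 / 5 \<le> v" unfolding v_def using exp_ge_add_one_self[of "1/5::real"] by simp
  have e3: "15 \<le> exp (3::real)"
  proof -
    have "(15::real) \<le> (6 / 5) ^ 15" by (simp add: power_divide)
    also have "\<dots> \<le> v ^ 15" using v by (intro power_mono) auto
    also have "\<dots> = exp 3" unfolding v_def by (simp add: exp_of_nat_mult[symmetric])
    finally show ?thesis .
  qed
  have e32: "3 \<le> exp (3 / 2 :: real)"
  proof -
    have "(3 / 2) ^ 3 \<le> exp (1/2 :: real) ^ 3" using exp_ge_add_one_self[of "1/2::real"] by (intro power_mono) auto
    also have "\<dots> = exp (3 / 2)" by (simp add: exp_of_nat_mult[symmetric])
    finally show ?thesis by (simp add: power_divide)
  qed
  have hj: "real (p choose j) * h j \<le> (1 / 2) ^ j" if jp: "j \<le> p" for j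
  proof -
    let ?l = "real j * ln (exp 1 * real p / real j)"
    have l0: "0 \<le> ?l" by (rule support_log_nonneg[OF jp])
    have ch: "real (p choose j) \<le> exp ?l"
      using binomial_le_exp_pow[of j p] jp by (cases "j = 0") auto
    have A: "15 ^ n' * exp (- 3 * real n) \<le> 1"
    proof -
      have "(15::real) ^ n' \<le> 15 ^ n" using n' by (intro power_increasing) auto
      also have "\<dots> \<le> exp 3 ^ n" using e3 by (intro power_mono) auto
      also have "\<dots> = exp (3 * real n)" by (simp add: exp_of_nat_mult[symmetric] mult.commute)
      finally show ?thesis by (simp add: exp_minus field_simps)
    qed
    have B: "3 ^ j * exp (- (3 / 2) * (ln (2 * exp 1) * real j)) \<le> (1 / 2) ^ j"
    proof -
      have ln2: "ln (2 * exp 1) = ln 2 + (1::real)" by (simp add: ln_mult)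
      have "exp (- (3 / 2) * (ln (2 * exp 1) * real j)) = exp (- (3 / 2) * (ln 2 + 1)) ^ j"
        unfolding ln2 by (simp add: exp_of_nat_mult[symmetric] algebra_simps)
      moreover have "3 * exp (- (3 / 2) * (ln 2 + 1)) \<le> (1 / 2 :: real)"
      proof -
        have "exp (- (3 / 2) * (ln 2 + 1)) \<le> exp (- (3 / 2) - ln (2::real))"
        proof -
          have "0 \<le> ln (2::real)" by simp
          then have "- (3 / 2) * (ln 2 + 1) \<le> - (3 / 2) - ln (2::real)" by (simp only: distrib_left)
          then show ?thesis by (simp only: exp_le_cancel_iff)
        qed
        also have "\<dots> = inverse (exp (3 / 2)) / exp (ln 2)" by (simp only: exp_diff exp_minus)
        also have "\<dots> = 1 / (2 * exp (3 / 2))" by (simp add: field_simps)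
        also have "\<dots> \<le> 1 / (2 * 3)" using e32 by (intro divide_left_mono) auto
        finally show ?thesis by simp
      qed
      then have "(3 * exp (- (3 / 2) * (ln 2 + 1))) ^ j \<le> (1 / 2 :: real) ^ j"
        by (rule power_mono) simp
      ultimately show ?thesis by (simp only: power_mult_distrib)
    qed
    have "h j = (15 ^ n' * exp (- 3 * real n)) * (3 ^ j * exp (- (3 / 2) * (ln (2 * exp 1) * real j))) * exp (- (3 / 2) * ?l)"
      unfolding h_def by (simp add: exp_add[symmetric] algebra_simps)
    also have "\<dots> \<le> 1 * (1 / 2) ^ j * exp (- ?l)"
      using A B l0 by (intro mult_mono) auto
    finally have "h j \<le> (1 / 2) ^ j * exp (- ?l)" by simp
    then have "real (p choose j) * h j \<le> exp ?l * ((1 / 2) ^ j * exp (- ?l))"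
      using ch by (intro mult_mono) (auto simp: h_def)
    also have "\<dots> = (1 / 2) ^ j" by (simp add: exp_minus field_simps)
    finally show ?thesis .
  qed
  have "(\<Sum>J\<in>Pow {..<p}. h (card J)) = (\<Sum>j\<in>{..p}. \<Sum>J\<in>{J. J \<in> Pow {..<p} \<and> card J = j}. h (card J))"
    by (rule sum.group[symmetric]) (auto intro: card_mono[of "{..<p}", simplified])
  also have "\<dots> = (\<Sum>j\<in>{..p}. real (p choose j) * h j)"
  proof (rule sum.cong[OF refl])
    fix j
    have "card {J. J \<in> Pow {..<p} \<and> card J = j} = p choose j"
      using n_subsets[of "{..<p}" j] by simp
    then show "(\<Sum>J\<in>{J. J \<in> Pow {..<p} \<and> card J = j}. h (card J)) = real (p choose j) * h j" by simp
  qed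
  also have "\<dots> \<le> (\<Sum>j\<in>{..p}. (1 / 2) ^ j)" using hj by (intro sum_mono) auto
  also have "\<dots> \<le> 2"
    using sum_le_suminf[of "\<lambda>j. (1 / 2 :: real) ^ j" "{..p}"] by (simp add: suminf_geometric summable_geometric)
  finally show ?thesis unfolding h_def .
qed

section \<open>The oracle inequality and its consequences\<close>

lemma frob_sq_eq_ip:
  assumes "C \<in> carrier_mat m n"
  shows "frob_sq C = ip ({..<m} \<times> {..<n}) (\<lambda>i. C $$ i) (\<lambda>i. C $$ i)"
  using assms unfolding frob_sq_def ip_self_eq by (simp add: sum.cartesian_product case_prod_unfold)

lemma frob_sq_diff_eq_ip:
  assumes C: "C \<in> carrier_mat m n" and D: "D \<in> carrier_mat m n"
  shows "frob_sq (C - D) = ip ({..<m} \<times> {..<n}) (\<lambda>i. C $$ i - D $$ i) (\<lambda>i. C $$ i - D $$ i)"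
proof -
  have CD: "C - D \<in> carrier_mat m n" using D by (rule minus_carrier_mat)
  have "(C - D) $$ i = C $$ i - D $$ i" if "i \<in> {..<m} \<times> {..<n}" for i
    using that C D by auto
  then show ?thesis unfolding frob_sq_eq_ip[OF CD] by (intro ip_cong) auto
qed

lemma index_mult_mat_sum:
  assumes "X \<in> carrier_mat m p" "B \<in> carrier_mat p n" "s < m" "t < n"
  shows "(X * B) $$ (s, t) = (\<Sum>i<p. X $$ (s, i) * B $$ (i, t))"
  using assms by (simp add: scalar_prod_def lessThan_atLeast0)

lemma card_nonzero_rows_le: "B \<in> carrier_mat p n \<Longrightarrow> card (nonzero_rows B) \<le> p"
  using card_mono[of "{..<p}" "nonzero_rows B"] by (auto simp: nonzero_rows_def)

lemma finite_nonzero_rows [simp]: "finite (nonzero_rows B)"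
  unfolding nonzero_rows_def by simp

lemma nonzero_rows_subset: "B \<in> carrier_mat p n \<Longrightarrow> nonzero_rows B \<subseteq> {..<p}"
  by (auto simp: nonzero_rows_def)

text \<open>For a matrix of rank at least one the penalty dominates both remainder terms of the oracle inequality below.\<close>

lemma jrrs_pen_lower:
  assumes B: "B \<in> carrier_mat p n" and r: "1 \<le> mat_rank B"
  shows "24 * \<sigma>\<^sup>2 * real n + 12 * \<sigma>\<^sup>2 * real (mat_rank B) * real (card (nonzero_rows B)) \<le> jrrs_pen 12 \<sigma> B"
proof -
  let ?k = "real (card (nonzero_rows B))" and ?r = "real (mat_rank B)"
  have l: "0 \<le> ?k * ln (exp 1 * real p / ?k)" by (rule support_log_nonneg[OF card_nonzero_rows_le[OF B]])
  have "1 * ?k \<le> ln (2 * exp 1) * ?k" by (intro mult_right_mono) (auto simp: ln_mult)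
  then have "12 * \<sigma>\<^sup>2 * ?r * (2 * real n + ?k) \<le> 12 * \<sigma>\<^sup>2 * ?r * (2 * real n + ln (2 * exp 1) * ?k + ?k * ln (exp 1 * real p / ?k))"
    using l by (intro mult_left_mono) auto
  moreover have "12 * \<sigma>\<^sup>2 * 1 * (2 * real n) \<le> 12 * \<sigma>\<^sup>2 * ?r * (2 * real n)"
    using r by (intro mult_left_mono mult_right_mono) auto
  ultimately show ?thesis using B unfolding jrrs_pen_def Let_def by (simp add: algebra_simps)
qed

text \<open>The oracle inequality in integral form, without a condition on the rank of \<open>B\<close> and without prior knowledge of
  integrability.\<close>

lemma oracle_inequality:
  fixes M :: "'w measure"
  assumes set: "jrrs_setting M m p n \<sigma> X A E Y Bhat" and B: "B \<in> carrier_mat p n"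
  shows "(\<integral>\<^sup>+\<omega>. ennreal (frob_sq (X * A - X * Bhat \<omega>)) \<partial>M)
    \<le> ennreal (10 * frob_sq (X * A - X * B) + 5 / 2 * (jrrs_pen 12 \<sigma> B
        + 12 * \<sigma>\<^sup>2 * real (mat_rank B) * real (card (nonzero_rows B)) + 16 * real n * \<sigma>\<^sup>2))"
proof -
  have M: "prob_space M" and \<sigma>: "0 < \<sigma>" and X: "X \<in> carrier_mat m p" and A: "A \<in> carrier_mat p n"
    and noise: "gaussian_noise M m n \<sigma> E"
    and Y: "\<And>\<omega>. \<omega> \<in> space M \<Longrightarrow> Y \<omega> = X * A + E \<omega>"
    and est: "\<And>\<omega>. \<omega> \<in> space M \<Longrightarrow> is_jrrs_estimate 12 \<sigma> X (Y \<omega>) (Bhat \<omega>)"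
    using set unfolding jrrs_setting_def by blast+
  interpret prob_space M by (rule M)
  have Ec: "\<And>\<omega>. \<omega> \<in> space M \<Longrightarrow> E \<omega> \<in> carrier_mat m n" using noise unfolding gaussian_noise_def by blast
  let ?S = "{..<m}" and ?T = "{..<n}"
  let ?P = "{..<m} \<times> {..<n}"
  define G where "G = (\<lambda>st \<omega>. E \<omega> $$ st)"
  have gv: "gaussian_vector M ?P \<sigma> G"
  proof
    show "indep_vars (\<lambda>_. borel) G ?P" using noise unfolding gaussian_noise_def G_def by blast
    show "\<And>s. s \<in> ?P \<Longrightarrow> distributed M lborel (G s) (normal_density 0 \<sigma>)"
      using noise unfolding gaussian_noise_def G_def by auto
  qed (use \<sigma> in auto)
  interpret gv: gaussian_vector M ?P \<sigma> G by (rule gv)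
  let ?r = "mat_rank B" and ?J = "nonzero_rows B"
  define x where "x = (\<lambda>j s. X $$ (s, j))"
  obtain c d where cd: "\<And>i j. i < p \<Longrightarrow> j < n \<Longrightarrow> B $$ (i, j) = (\<Sum>l<?r. c l i * d l j)"
    using rank_factorization[OF B] by blast
  define N where "N = (\<lambda>st. (X * B) $$ st)"
  have mvN: "mv ?T N y s = (\<Sum>i<p. ip ?T (\<lambda>t. B $$ (i, t)) y * x i s)" if "s \<in> ?S" for y s
  proof (rule mv_lincomb_tens)
    fix t assume "t \<in> ?T"
    then show "N (s, t) = (\<Sum>i<p. x i s * B $$ (i, t))"
      using index_mult_mat_sum[OF X B, of s t] that by (simp add: N_def x_def)
  qed
  have "onf ?T {..<0::nat} (\<lambda>_ _. 0)" by (simp add: onf_def)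
  from gram_schmidt_extend[OF _ _ this, of "d ` {..<?r}"]
  obtain q0 r' where r': "r' \<le> card (d ` {..<?r})" and q0: "onf ?T {..<r'} q0"
    and dq0: "\<And>l. l < ?r \<Longrightarrow> in_span ?T {..<r'} q0 (d l)" by auto
  have r'r: "r' \<le> ?r" using r' card_image_le[of "{..<?r}" d] by simp
  obtain q n' where rn: "r' \<le> n'" and n'n: "n' \<le> n" and qq: "\<forall>i<r'. q i = q0 i" and q: "onf ?T {..<n'} q"
    and qsp: "\<And>y. in_span ?T {..<n'} q y"
    using onb_extend[OF _ q0] by auto
  have dq: "in_span ?T {..<r'} q (d l)" if "l < ?r" for l
    by (rule in_span_cong[OF dq0[OF that]]) (use qq in auto)
  have rowq: "in_span ?T {..<r'} q (\<lambda>t. B $$ (i, t))" if "i < p" for i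
    by (rule in_span_cong[OF in_span_sum[of "{..<?r}" ?T "{..<r'}" q d "\<lambda>l. c l i"]]) (use dq cd that in auto)
  have "onf ?S {..<0::nat} (\<lambda>_ _. 0)" by (simp add: onf_def)
  from gram_schmidt_extend[OF _ _ this, of "x ` ?J"]
  obtain e0 J0 where J0: "J0 \<le> card (x ` ?J)" and e0: "onf ?S {..<J0} e0"
    and xe0: "\<And>j. j \<in> ?J \<Longrightarrow> in_span ?S {..<J0} e0 (x j)" by auto
  have J0J: "J0 \<le> card ?J" using J0 card_image_le[of ?J x] by simp
  have N0: "mv ?T N (q j) s = 0" if "r' \<le> j" "j < n'" "s \<in> ?S" for j s
  proof -
    have "ip ?T (\<lambda>t. B $$ (i, t)) (q j) = 0" if "i < p" for i
      by (rule in_span_orthogonal[OF q _ _ rowq[OF that]]) (use \<open>r' \<le> j\<close> \<open>j < n'\<close> rn in auto)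
    then show ?thesis using mvN[OF that(3)] by simp
  qed
  have N1: "in_span ?S {..<J0} e0 (mv ?T N y)" for y
  proof (rule in_span_cong[OF in_span_sum[of ?J ?S "{..<J0}" e0 x "\<lambda>i. ip ?T (\<lambda>t. B $$ (i, t)) y"]])
    fix s assume s: "s \<in> ?S"
    have "B $$ (i, t) = 0" if "i < p" "i \<notin> ?J" "t < n" for i t
    proof -
      have "row B i = 0\<^sub>v n" using that B by (auto simp: nonzero_rows_def)
      then have "row B i $ t = 0" using that by simp
      then show ?thesis using that B by simp
    qed
    then have "ip ?T (\<lambda>t. B $$ (i, t)) y = 0" if "i < p" "i \<notin> ?J" for i using that by (simp add: ip_def)
    then have "(\<Sum>i<p. ip ?T (\<lambda>t. B $$ (i, t)) y * x i s) = (\<Sum>i\<in>?J. ip ?T (\<lambda>t. B $$ (i, t)) y * x i s)"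
      using nonzero_rows_subset[OF B] by (intro sum.mono_neutral_right) auto
    then show "(\<Sum>i\<in>?J. ip ?T (\<lambda>t. B $$ (i, t)) y * x i s) = mv ?T N y s" using mvN[OF s] by simp
  qed (use xe0 in auto)
  \<comment> \<open>The threshold is chosen such that \<open>2 r \<theta>\<close> is the penalty of a matrix of rank \<open>r\<close> and support \<open>J\<close>.\<close>
  define \<theta> where "\<theta> = (\<lambda>J::nat set. 6 * \<sigma>\<^sup>2 * (2 * real n + ln (2 * exp 1) * real (card J) + real (card J) * ln (exp 1 * real p / real (card J))))"
  define F where "F = (\<lambda>\<omega>. \<Sum>i<J0. \<Sum>j<r'. (gv.coord (tens (e0 i) (q j)) \<omega>)\<^sup>2)"
  have [measurable]: "F \<in> borel_measurable M" unfolding F_def by measurable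
  have "\<forall>J\<in>Pow {..<p}. \<exists>R. R \<in> borel_measurable M \<and> (\<forall>\<omega>. 0 \<le> R \<omega>) \<and>
    (\<integral>\<^sup>+\<omega>. ennreal (R \<omega>) \<partial>M) \<le> ennreal (4 * \<sigma>\<^sup>2 * (15 ^ n' * 3 ^ card J * exp (- \<theta> J / (4 * \<sigma>\<^sup>2)))) \<and>
    (\<forall>\<omega> k a b U. (\<forall>s\<in>?S. \<forall>t\<in>?T. U (s, t) = (\<Sum>l<k. a l s * b l t)) \<longrightarrow> (\<forall>l<k. in_span ?S J x (a l)) \<longrightarrow>
      2 * ip ?P (\<lambda>i. G i \<omega>) (\<lambda>i. U i - N i) \<le> ip ?P (\<lambda>i. U i - N i) (\<lambda>i. U i - N i) / 2
        + 2 * F \<omega> + 2 * (real k * (\<theta> J + R \<omega>)))"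
    unfolding F_def gv.coord_def
    by (intro ballI selection_noise_bound[OF gv _ _ e0 q qsp rn N0 N1]) (auto intro: finite_subset)
  then obtain R where Rm: "\<And>J. J \<in> Pow {..<p} \<Longrightarrow> R J \<in> borel_measurable M"
    and R0: "\<And>J \<omega>. J \<in> Pow {..<p} \<Longrightarrow> 0 \<le> R J \<omega>"
    and RE: "\<And>J. J \<in> Pow {..<p} \<Longrightarrow> (\<integral>\<^sup>+\<omega>. ennreal (R J \<omega>) \<partial>M) \<le> ennreal (4 * \<sigma>\<^sup>2 * (15 ^ n' * 3 ^ card J * exp (- \<theta> J / (4 * \<sigma>\<^sup>2))))"
    and RB: "\<And>J \<omega> k a b U. J \<in> Pow {..<p} \<Longrightarrow> (\<forall>s\<in>?S. \<forall>t\<in>?T. U (s, t) = (\<Sum>l<k. a l s * b l t)) \<Longrightarrow> (\<forall>l<k. in_span ?S J x (a l)) \<Longrightarrow>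
      2 * ip ?P (\<lambda>i. G i \<omega>) (\<lambda>i. U i - N i) \<le> ip ?P (\<lambda>i. U i - N i) (\<lambda>i. U i - N i) / 2
        + 2 * F \<omega> + 2 * (real k * (\<theta> J + R J \<omega>))"
    unfolding bchoice_iff by blast
  define H where "H = (\<lambda>\<omega>. \<Sum>J\<in>Pow {..<p}. R J \<omega>)"
  have [measurable]: "H \<in> borel_measurable M" unfolding H_def using Rm by (intro borel_measurable_sum)
  have F0: "0 \<le> F \<omega>" for \<omega> unfolding F_def by (intro sum_nonneg) simp
  have H0: "0 \<le> H \<omega>" for \<omega> unfolding H_def by (intro sum_nonneg R0)
  define K where "K = 10 * frob_sq (X * A - X * B) + 5 / 2 * jrrs_pen 12 \<sigma> B"
  have XB: "X * B \<in> carrier_mat m n" and XA: "X * A \<in> carrier_mat m n" using X A B by auto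
  have pointwise: "frob_sq (X * A - X * Bhat \<omega>) \<le> K + 5 * F \<omega> + 5 * real n * H \<omega>" if \<omega>: "\<omega> \<in> space M" for \<omega>
  proof -
    have Yc: "Y \<omega> \<in> carrier_mat m n" using Y[OF \<omega>] Ec[OF \<omega>] XA by auto
    have Bh: "Bhat \<omega> \<in> carrier_mat p n"
      and opt: "frob_sq (Y \<omega> - X * Bhat \<omega>) + jrrs_pen 12 \<sigma> (Bhat \<omega>) \<le> frob_sq (Y \<omega> - X * B) + jrrs_pen 12 \<sigma> B"
      using est[OF \<omega>] X Yc B unfolding is_jrrs_estimate_def is_arg_min_linorder by auto
    let ?k = "mat_rank (Bhat \<omega>)" and ?Jh = "nonzero_rows (Bhat \<omega>)"
    have XBh: "X * Bhat \<omega> \<in> carrier_mat m n" using X Bh by auto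
    define U where "U = (\<lambda>i. (X * Bhat \<omega>) $$ i)"
    define V where "V = (\<lambda>i. (X * A) $$ i)"
    define g where "g = (\<lambda>i. G i \<omega>)"
    obtain c' d' where cd': "\<And>i j. i < p \<Longrightarrow> j < n \<Longrightarrow> Bhat \<omega> $$ (i, j) = (\<Sum>l<?k. c' l i * d' l j)"
      and c'0: "\<And>l i. l < ?k \<Longrightarrow> i < p \<Longrightarrow> i \<notin> ?Jh \<Longrightarrow> c' l i = 0"
      using rank_factorization[OF Bh] by blast
    define a where "a = (\<lambda>l s. \<Sum>i<p. c' l i * x i s)"
    have Jh: "?Jh \<in> Pow {..<p}" using nonzero_rows_subset[OF Bh] by blast
    have Uf: "\<forall>s\<in>?S. \<forall>t\<in>?T. U (s, t) = (\<Sum>l<?k. a l s * d' l t)"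
    proof (intro ballI)
      fix s t assume st: "s \<in> ?S" "t \<in> ?T"
      have "U (s, t) = (\<Sum>i<p. x i s * (\<Sum>l<?k. c' l i * d' l t))"
        using index_mult_mat_sum[OF X Bh, of s t] cd' st by (simp add: U_def x_def)
      also have "\<dots> = (\<Sum>l<?k. \<Sum>i<p. c' l i * x i s * d' l t)"
        unfolding sum_distrib_left by (subst sum.swap) (simp add: mult_ac)
      finally show "U (s, t) = (\<Sum>l<?k. a l s * d' l t)" unfolding a_def sum_distrib_right .
    qed
    have asp: "\<forall>l<?k. in_span ?S ?Jh x (a l)" unfolding in_span_def
    proof (intro allI impI exI ballI)
      fix l s assume "l < ?k"
      then show "a l s = (\<Sum>i\<in>?Jh. c' l i * x i s)" unfolding a_def
        using nonzero_rows_subset[OF Bh] c'0 by (intro sum.mono_neutral_right) auto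
    qed
    let ?D = "\<lambda>i. U i - N i" and ?u = "\<lambda>i. V i - U i" and ?v = "\<lambda>i. V i - N i"
    have nb: "2 * ip ?P g ?D \<le> ip ?P ?D ?D / 2 + 2 * F \<omega> + 2 * (real ?k * (\<theta> ?Jh + R ?Jh \<omega>))"
      unfolding g_def by (rule RB[OF Jh Uf asp])
    have fu: "frob_sq (X * A - X * Bhat \<omega>) = ip ?P ?u ?u"
      unfolding V_def U_def by (rule frob_sq_diff_eq_ip[OF XA XBh])
    have fv: "frob_sq (X * A - X * B) = ip ?P ?v ?v"
      unfolding V_def N_def by (rule frob_sq_diff_eq_ip[OF XA XB])
    have Yi: "Y \<omega> $$ i = V i + g i" if "i \<in> ?P" for i
      using that XA Ec[OF \<omega>] unfolding Y[OF \<omega>] V_def g_def G_def by auto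
    have fYu: "frob_sq (Y \<omega> - X * Bhat \<omega>) = ip ?P (\<lambda>i. ?u i + g i) (\<lambda>i. ?u i + g i)"
      unfolding frob_sq_diff_eq_ip[OF Yc XBh] by (intro ip_cong) (simp_all add: Yi U_def)
    have fYv: "frob_sq (Y \<omega> - X * B) = ip ?P (\<lambda>i. ?v i + g i) (\<lambda>i. ?v i + g i)"
      unfolding frob_sq_diff_eq_ip[OF Yc XB] by (intro ip_cong) (simp_all add: Yi N_def)
    \<comment> \<open>The basic inequality: the estimator does at least as well on the criterion as \<open>B\<close>.\<close>
    have basic: "ip ?P ?u ?u + jrrs_pen 12 \<sigma> (Bhat \<omega>) \<le> ip ?P ?v ?v + jrrs_pen 12 \<sigma> B + 2 * ip ?P g ?D"
    proof -
      have ex: "ip ?P (\<lambda>i. y i + g i) (\<lambda>i. y i + g i) = ip ?P y y + 2 * ip ?P g y + ip ?P g g" for y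
        by (simp add: ip_add_left ip_add_right ip_commute[of ?P y g])
      have "ip ?P g ?D = ip ?P g ?v - ip ?P g ?u" by (simp add: ip_diff_right)
      then show ?thesis using opt unfolding fYu fYv ex by linarith
    qed
    \<comment> \<open>With these weights, absorbing half of the left side leaves \<open>2/5\<close> of the loss against \<open>4\<close> times the
        squared bias, whence the factors \<open>5/2\<close> and \<open>10\<close>.\<close>
    have tri: "ip ?P ?D ?D \<le> 6 / 5 * ip ?P ?u ?u + 6 * ip ?P ?v ?v"
    proof -
      have "(U i - N i) * (U i - N i) \<le> 6 / 5 * ((V i - U i) * (V i - U i)) + 6 * ((V i - N i) * (V i - N i))" for i
      proof -
        have "0 \<le> ((V i - U i) + 5 * (V i - N i))\<^sup>2 / 5" by simp
        then show ?thesis by (simp add: power2_eq_square algebra_simps)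
      qed
      then show ?thesis unfolding ip_def sum_distrib_left sum.distrib[symmetric] by (intro sum_mono)
    qed
    have pen: "2 * (real ?k * \<theta> ?Jh) = jrrs_pen 12 \<sigma> (Bhat \<omega>)"
      using Bh unfolding jrrs_pen_def Let_def \<theta>_def by (simp add: algebra_simps)
    have "R ?Jh \<omega> \<le> H \<omega>" unfolding H_def using Jh R0 by (intro member_le_sum) auto
    \<comment> \<open>The support of the estimator is random, so the excess is bounded by the sum over all supports.\<close>
    then have "real ?k * R ?Jh \<omega> \<le> real n * H \<omega>"
      using mat_rank_le[OF Bh] R0[OF Jh] by (intro mult_mono) auto
    then show ?thesis using basic tri nb pen unfolding fu K_def fv by (simp add: distrib_left)
  qed
  have EF: "(\<integral>\<^sup>+\<omega>. ennreal (F \<omega>) \<partial>M) \<le> ennreal (6 * \<sigma>\<^sup>2 * (real ?r * real (card ?J)))"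
  proof -
    have "(\<integral>\<^sup>+\<omega>. ennreal (F \<omega>) \<partial>M) = (\<Sum>i<J0. \<Sum>j<r'. \<integral>\<^sup>+\<omega>. ennreal ((gv.coord (tens (e0 i) (q j)) \<omega>)\<^sup>2) \<partial>M)"
    proof -
      have "ennreal (F \<omega>) = (\<Sum>i<J0. \<Sum>j<r'. ennreal ((gv.coord (tens (e0 i) (q j)) \<omega>)\<^sup>2))" for \<omega>
        unfolding F_def by (simp add: sum_nonneg)
      then show ?thesis by (simp add: nn_integral_sum del: sum_ennreal)
    qed
    also have "\<dots> \<le> (\<Sum>i<J0. \<Sum>j<r'. ennreal (6 * \<sigma>\<^sup>2))"
    proof (intro sum_mono gv.nn_integral_coord_square_le)
      fix i j assume ij: "i \<in> {..<J0}" "j \<in> {..<r'}"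
      then show "ip ?P (tens (e0 i) (q j)) (tens (e0 i) (q j)) \<le> 1"
        using onfD[OF e0, of i i] onfD[OF q, of j j] rn by (simp add: ip_tens)
    qed
    also have "\<dots> = ennreal (real J0 * (real r' * (6 * \<sigma>\<^sup>2)))"
      by (simp add: ennreal_mult ennreal_of_nat_eq_real_of_nat)
    also have "\<dots> \<le> ennreal (6 * \<sigma>\<^sup>2 * (real ?r * real (card ?J)))"
    proof (intro ennreal_leI)
      have "real J0 * (real r' * (6 * \<sigma>\<^sup>2)) \<le> real (card ?J) * (real ?r * (6 * \<sigma>\<^sup>2))"
        using J0J r'r by (intro mult_mono) auto
      then show "real J0 * (real r' * (6 * \<sigma>\<^sup>2)) \<le> 6 * \<sigma>\<^sup>2 * (real ?r * real (card ?J))" by (simp add: mult_ac)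
    qed
    finally show ?thesis .
  qed
  have EH: "(\<integral>\<^sup>+\<omega>. ennreal (H \<omega>) \<partial>M) \<le> ennreal (8 * \<sigma>\<^sup>2)"
  proof -
    have "(\<integral>\<^sup>+\<omega>. ennreal (H \<omega>) \<partial>M) = (\<integral>\<^sup>+\<omega>. (\<Sum>J\<in>Pow {..<p}. ennreal (R J \<omega>)) \<partial>M)"
      unfolding H_def using R0 by (intro nn_integral_cong sum_ennreal[symmetric])
    also have "\<dots> = (\<Sum>J\<in>Pow {..<p}. \<integral>\<^sup>+\<omega>. ennreal (R J \<omega>) \<partial>M)"
      using Rm by (intro nn_integral_sum) auto
    also have "\<dots> \<le> (\<Sum>J\<in>Pow {..<p}. ennreal (4 * \<sigma>\<^sup>2 * (15 ^ n' * 3 ^ card J * exp (- \<theta> J / (4 * \<sigma>\<^sup>2)))))"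
      by (intro sum_mono RE)
    also have "\<dots> = ennreal (4 * \<sigma>\<^sup>2 * (\<Sum>J\<in>Pow {..<p}. 15 ^ n' * 3 ^ card J * exp (- \<theta> J / (4 * \<sigma>\<^sup>2))))"
      by (simp add: sum_ennreal sum_distrib_left)
    also have "\<dots> \<le> ennreal (4 * \<sigma>\<^sup>2 * 2)"
    proof (intro ennreal_leI mult_left_mono)
      have eq: "- \<theta> J / (4 * \<sigma>\<^sup>2) = - (3 / 2) * (2 * real n + ln (2 * exp 1) * real (card J) + real (card J) * ln (exp 1 * real p / real (card J)))" for J
        using \<sigma> unfolding \<theta>_def by (simp add: field_simps)
      show "(\<Sum>J\<in>Pow {..<p}. 15 ^ n' * 3 ^ card J * exp (- \<theta> J / (4 * \<sigma>\<^sup>2))) \<le> 2"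
        unfolding eq by (rule sum_over_supports_le[OF n'n])
    qed simp
    finally show ?thesis by simp
  qed
  have pen0: "0 \<le> jrrs_pen 12 \<sigma> B"
  proof -
    have "0 \<le> ln (2 * exp (1::real))" by (simp add: ln_mult)
    then have "0 \<le> 2 * real n + ln (2 * exp 1) * real (card ?J) + real (card ?J) * ln (exp 1 * real p / real (card ?J))"
      by (intro add_nonneg_nonneg support_log_nonneg[OF card_nonzero_rows_le[OF B]]) simp_all
    then have "0 \<le> 12 * \<sigma>\<^sup>2 * real ?r * (2 * real n + ln (2 * exp 1) * real (card ?J) + real (card ?J) * ln (exp 1 * real p / real (card ?J)))"
      by (intro mult_nonneg_nonneg[of "12 * \<sigma>\<^sup>2 * real ?r"]) simp_all
    then show ?thesis using B unfolding jrrs_pen_def Let_def by simp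
  qed
  have K0: "0 \<le> K" unfolding K_def using pen0 by (simp add: frob_sq_def sum_nonneg)
  have "(\<integral>\<^sup>+\<omega>. ennreal (frob_sq (X * A - X * Bhat \<omega>)) \<partial>M)
     \<le> (\<integral>\<^sup>+\<omega>. ennreal K + (ennreal 5 * ennreal (F \<omega>) + ennreal (5 * real n) * ennreal (H \<omega>)) \<partial>M)"
  proof (rule nn_integral_mono)
    fix \<omega> assume "\<omega> \<in> space M"
    then have "ennreal (frob_sq (X * A - X * Bhat \<omega>)) \<le> ennreal (K + (5 * F \<omega> + 5 * real n * H \<omega>))"
      using pointwise by (intro ennreal_leI) (simp add: add.assoc)
    also have "\<dots> = ennreal K + (ennreal 5 * ennreal (F \<omega>) + ennreal (5 * real n) * ennreal (H \<omega>))"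
      using K0 F0 H0 by (simp only: ennreal_plus ennreal_mult add_nonneg_nonneg mult_nonneg_nonneg of_nat_0_le_iff zero_le_numeral)
    finally show "ennreal (frob_sq (X * A - X * Bhat \<omega>)) \<le> \<dots>" .
  qed
  also have "\<dots> = ennreal K + (ennreal 5 * (\<integral>\<^sup>+\<omega>. ennreal (F \<omega>) \<partial>M) + ennreal (5 * real n) * (\<integral>\<^sup>+\<omega>. ennreal (H \<omega>) \<partial>M))"
    by (simp add: nn_integral_add nn_integral_cmult emeasure_space_1)
  also have "\<dots> \<le> ennreal K + (ennreal 5 * ennreal (6 * \<sigma>\<^sup>2 * (real ?r * real (card ?J))) + ennreal (5 * real n) * ennreal (8 * \<sigma>\<^sup>2))"
    by (intro add_mono mult_left_mono EF EH) auto
  also have "\<dots> = ennreal (K + (5 * (6 * \<sigma>\<^sup>2 * (real ?r * real (card ?J))) + 5 * real n * (8 * \<sigma>\<^sup>2)))"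
    using K0 by (simp only: ennreal_plus ennreal_mult add_nonneg_nonneg mult_nonneg_nonneg of_nat_0_le_iff zero_le_numeral zero_le_power2)
  also have "K + (5 * (6 * \<sigma>\<^sup>2 * (real ?r * real (card ?J))) + 5 * real n * (8 * \<sigma>\<^sup>2))
     = 10 * frob_sq (X * A - X * B) + 5 / 2 * (jrrs_pen 12 \<sigma> B
        + 12 * \<sigma>\<^sup>2 * real ?r * real (card ?J) + 16 * real n * \<sigma>\<^sup>2)"
    unfolding K_def by (simp add: algebra_simps)
  finally show ?thesis .
qed

lemma integrable_and_risk_bound:
  fixes M :: "'w measure"
  assumes set: "jrrs_setting M m p n \<sigma> X A E Y Bhat" and B: "B \<in> carrier_mat p n"
  shows "integrable M (\<lambda>\<omega>. frob_sq (X * A - X * Bhat \<omega>))"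
    and "1 \<le> mat_rank B \<Longrightarrow> prediction_risk M X A Bhat \<le> 10 * frob_sq (X * A - X * B) + 8 * jrrs_pen 12 \<sigma> B"
proof -
  have X: "X \<in> carrier_mat m p" and A: "A \<in> carrier_mat p n" and noise: "gaussian_noise M m n \<sigma> E"
    and Y: "\<And>\<omega>. \<omega> \<in> space M \<Longrightarrow> Y \<omega> = X * A + E \<omega>"
    and meas: "\<And>i j. i < p \<Longrightarrow> j < n \<Longrightarrow> (\<lambda>\<omega>. Bhat \<omega> $$ (i, j)) \<in> borel_measurable M"
    and est: "\<And>\<omega>. \<omega> \<in> space M \<Longrightarrow> is_jrrs_estimate 12 \<sigma> X (Y \<omega>) (Bhat \<omega>)"
    using set unfolding jrrs_setting_def by blast+
  let ?f = "\<lambda>\<omega>. frob_sq (X * A - X * Bhat \<omega>)"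
  let ?b = "10 * frob_sq (X * A - X * B) + 5 / 2 * (jrrs_pen 12 \<sigma> B
        + 12 * \<sigma>\<^sup>2 * real (mat_rank B) * real (card (nonzero_rows B)) + 16 * real n * \<sigma>\<^sup>2)"
  have f0: "0 \<le> ?f \<omega>" for \<omega> by (simp add: frob_sq_def sum_nonneg)
  have eq: "?f \<omega> = (\<Sum>s<m. \<Sum>t<n. ((X * A) $$ (s, t) - (\<Sum>i<p. X $$ (s, i) * Bhat \<omega> $$ (i, t)))\<^sup>2)"
    if \<omega>: "\<omega> \<in> space M" for \<omega>
  proof -
    have "E \<omega> \<in> carrier_mat m n" using noise \<omega> unfolding gaussian_noise_def by blast
    then have "Y \<omega> \<in> carrier_mat m n" using Y[OF \<omega>] X A by auto
    then have Bh: "Bhat \<omega> \<in> carrier_mat p n"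
      using est[OF \<omega>] X unfolding is_jrrs_estimate_def is_arg_min_def by auto
    have "X * A - X * Bhat \<omega> \<in> carrier_mat m n" using X A Bh by auto
    then show ?thesis using X A Bh index_mult_mat_sum[OF X Bh]
      unfolding frob_sq_def by (auto intro!: sum.cong simp del: index_mult_mat(1))
  qed
  have "(\<lambda>\<omega>. \<Sum>s<m. \<Sum>t<n. ((X * A) $$ (s, t) - (\<Sum>i<p. X $$ (s, i) * Bhat \<omega> $$ (i, t)))\<^sup>2) \<in> borel_measurable M"
    by (intro borel_measurable_sum borel_measurable_power borel_measurable_diff borel_measurable_times borel_measurable_const meas) auto
  then have fm: "?f \<in> borel_measurable M" using measurable_cong[of M ?f] eq by simp
  have le: "(\<integral>\<^sup>+\<omega>. ennreal (?f \<omega>) \<partial>M) \<le> ennreal ?b" by (rule oracle_inequality[OF set B])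
  show int: "integrable M ?f"
    using fm f0 le by (intro integrableI_nonneg) (auto simp: le_less_trans[OF _ ennreal_less_top])
  assume r: "1 \<le> mat_rank B"
  have low: "24 * \<sigma>\<^sup>2 * real n + 12 * \<sigma>\<^sup>2 * real (mat_rank B) * real (card (nonzero_rows B)) \<le> jrrs_pen 12 \<sigma> B"
    by (rule jrrs_pen_lower[OF B r])
  define u where "u = \<sigma>\<^sup>2 * real n"
  define v where "v = \<sigma>\<^sup>2 * real (mat_rank B) * real (card (nonzero_rows B))"
  define f where "f = frob_sq (X * A - X * B)"
  have b: "?b = 10 * f + 5 / 2 * (jrrs_pen 12 \<sigma> B + 12 * v + 16 * u)"
    by (simp add: u_def v_def f_def)
  have nn: "0 \<le> u" "0 \<le> v" "0 \<le> f"
    by (simp_all add: u_def v_def f_def frob_sq_def sum_nonneg)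
  have low': "24 * u + 12 * v \<le> jrrs_pen 12 \<sigma> B" using low by (simp add: u_def v_def)
  have "0 \<le> ?b" unfolding b using low' nn by argo
  moreover have "ennreal (prediction_risk M X A Bhat) \<le> ennreal ?b"
    using le nn_integral_eq_integral[OF int] f0 unfolding prediction_risk_def by simp
  ultimately have "prediction_risk M X A Bhat \<le> ?b" by (simp add: ennreal_le_iff)
  also have "\<dots> \<le> 10 * frob_sq (X * A - X * B) + 8 * jrrs_pen 12 \<sigma> B"
    unfolding b unfolding f_def[symmetric] using low' nn by argo
  finally show "prediction_risk M X A Bhat \<le> 10 * frob_sq (X * A - X * B) + 8 * jrrs_pen 12 \<sigma> B" .
qed

lemma risk_le_pen:
  assumes set: "jrrs_setting M m p n \<sigma> X A E Y Bhat" and r: "1 \<le> mat_rank A"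
  shows "prediction_risk M X A Bhat \<le> 8 * jrrs_pen 12 \<sigma> A"
proof -
  have A: "A \<in> carrier_mat p n" and X: "X \<in> carrier_mat m p" using set unfolding jrrs_setting_def by blast+
  have "frob_sq (X * A - X * A) = 0" using A X by (simp add: frob_sq_def)
  then show ?thesis using integrable_and_risk_bound(2)[OF set A r] by simp
qed

text \<open>For a nonempty support \<open>J\<close> the logarithm is at least \<open>1\<close> and \<open>ln (2 e) \<le> 2\<close>, so the bracket in the penalty is
  at most three times \<open>n + \<bar>J\<bar> ln (e p / \<bar>J\<bar>)\<close>; the constant is \<open>8 * 12 * 3\<close>.\<close>

lemma pen_le_general:
  assumes A: "A \<in> carrier_mat p n"
  shows "8 * jrrs_pen 12 \<sigma> A \<le> 288 * (\<sigma>\<^sup>2 * real (mat_rank A) *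
     (real n + real (card (nonzero_rows A)) * ln (exp 1 * (real p / real (card (nonzero_rows A))))))"
proof (cases "card (nonzero_rows A) = 0")
  case True
  then show ?thesis using A unfolding jrrs_pen_def Let_def by simp
next
  case False
  let ?k = "real (card (nonzero_rows A))" and ?r = "real (mat_rank A)"
  let ?l = "ln (exp 1 * (real p / ?k))"
  have k: "?k > 0" "?k \<le> real p" using False card_nonzero_rows_le[OF A] by auto
  then have l: "?l = 1 + ln (real p / ?k)" "0 \<le> ln (real p / ?k)"
    using ln_mult[of "exp 1" "real p / ?k"] by auto
  have l2: "ln (2 * exp 1 :: real) \<le> 2" using ln_le_minus_one[of "2::real"] by (simp add: ln_mult)
  have "ln (2 * exp 1) \<le> 2 * ?l" using l2 l by linarith
  then have "ln (2 * exp 1) * ?k \<le> 2 * ?l * ?k" by (rule mult_right_mono) simp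
  then have "2 * real n + ln (2 * exp 1) * ?k + ?k * ?l \<le> 3 * (real n + ?k * ?l)" by (simp add: algebra_simps)
  then have "12 * \<sigma>\<^sup>2 * ?r * (2 * real n + ln (2 * exp 1) * ?k + ?k * ?l) \<le> 12 * \<sigma>\<^sup>2 * ?r * (3 * (real n + ?k * ?l))"
    by (intro mult_left_mono) auto
  then show ?thesis using A unfolding jrrs_pen_def Let_def by (simp add: algebra_simps)
qed

text \<open>The size of the support is absorbed either by \<open>n\<close> or, when \<open>p / \<bar>J\<bar> \<ge> 1 / \<delta>\<close>, by \<open>\<bar>J\<bar> ln (p / \<bar>J\<bar>)\<close> divided by
  \<open>ln (1 / \<delta>)\<close>.\<close>

lemma pen_le_sparse:
  assumes A: "A \<in> carrier_mat p n" and \<delta>: "0 < \<delta>" "\<delta> < 1"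
    and sp: "card (nonzero_rows A) \<le> n \<or> real (card (nonzero_rows A)) \<le> \<delta> * real p"
  shows "8 * jrrs_pen 12 \<sigma> A \<le> 96 * (5 + 3 / ln (1 / \<delta>)) * (\<sigma>\<^sup>2 * real (mat_rank A) *
     (real n + real (card (nonzero_rows A)) * ln (real p / real (card (nonzero_rows A)))))"
proof (cases "card (nonzero_rows A) = 0")
  case True
  have "0 < ln (1 / \<delta>)" using \<delta> by simp
  then have "2 \<le> 5 + 3 / ln (1 / \<delta>)" by (simp add: add_increasing2)
  then have "96 * (2 * (\<sigma>\<^sup>2 * real (mat_rank A) * real n)) \<le> 96 * ((5 + 3 / ln (1 / \<delta>)) * (\<sigma>\<^sup>2 * real (mat_rank A) * real n))"
    by (intro mult_left_mono mult_right_mono) auto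
  then show ?thesis using True A unfolding jrrs_pen_def Let_def by (simp add: mult_ac)
next
  case False
  let ?k = "real (card (nonzero_rows A))" and ?r = "real (mat_rank A)"
  let ?l = "ln (real p / ?k)" 
  define C where "C = 5 + 3 / ln (1 / \<delta>)"
  have k: "?k > 0" "?k \<le> real p" using False card_nonzero_rows_le[OF A] by auto
  then have l: "ln (exp 1 * real p / ?k) = 1 + ?l" "0 \<le> ?l"
    using ln_mult[of "exp 1" "real p / ?k"] by auto
  have d0: "0 < ln (1 / \<delta>)" using \<delta> by simp
  have l2: "ln (2 * exp 1 :: real) \<le> 2" using ln_le_minus_one[of "2::real"] by (simp add: ln_mult)
  have "ln (2 * exp 1) * ?k \<le> 2 * ?k" using l2 k by (intro mult_right_mono) auto
  then have up: "2 * real n + ln (2 * exp 1) * ?k + ?k * ln (exp 1 * real p / ?k) \<le> 2 * real n + 3 * ?k + ?k * ?l"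
    unfolding l(1) by (simp add: algebra_simps)
  have k_le: "?k \<le> real n + ?k * ?l / ln (1 / \<delta>)"
    using sp
  proof
    assume "card (nonzero_rows A) \<le> n"
    then have "?k \<le> real n" by simp
    moreover have "0 \<le> ?k * ?l / ln (1 / \<delta>)" using k l d0 by simp
    ultimately show ?thesis by linarith
  next
    assume "?k \<le> \<delta> * real p"
    then have "1 / \<delta> \<le> real p / ?k" using \<delta> k by (simp add: field_simps)
    then have "ln (1 / \<delta>) \<le> ?l" using \<delta> by (intro ln_mono) auto
    then have "?k * ln (1 / \<delta>) \<le> ?k * ?l" using k by (intro mult_left_mono) auto
    then have "?k \<le> ?k * ?l / ln (1 / \<delta>)" using d0 by (simp add: le_divide_eq)
    then show ?thesis by linarith
  qed
  have "3 * (?k * ?l / ln (1 / \<delta>)) = 3 / ln (1 / \<delta>) * (?k * ?l)" by simp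
  moreover have "0 \<le> 3 / ln (1 / \<delta>) * real n" "0 \<le> ?k * ?l" using d0 k l by simp_all
  ultimately have "2 * real n + 3 * ?k + ?k * ?l \<le> C * (real n + ?k * ?l)"
    using k_le unfolding C_def distrib_left distrib_right by linarith
  with up have "2 * real n + ln (2 * exp 1) * ?k + ?k * ln (exp 1 * real p / ?k) \<le> C * (real n + ?k * ?l)" by linarith
  then have "96 * (\<sigma>\<^sup>2 * ?r) * (2 * real n + ln (2 * exp 1) * ?k + ?k * ln (exp 1 * real p / ?k))
      \<le> 96 * (\<sigma>\<^sup>2 * ?r) * (C * (real n + ?k * ?l))"
    by (intro mult_left_mono) auto
  then show ?thesis using A unfolding C_def[symmetric] jrrs_pen_def Let_def by (simp add: mult_ac)
qed

theorem theorem1: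
  "(\<forall>(M :: 'w measure) m p n \<sigma> X A E Y Bhat.
      jrrs_setting M m p n \<sigma> X A E Y Bhat \<longrightarrow>
        integrable M (\<lambda>\<omega>. frob_sq (X * A - X * Bhat \<omega>)) \<and>
        (\<forall>B\<in>carrier_mat p n. 1 \<le> mat_rank B \<longrightarrow>
           prediction_risk M X A Bhat
             \<le> 10 * frob_sq (X * A - X * B) + 8 * jrrs_pen 12 \<sigma> B
                + 768 * real n * \<sigma>\<^sup>2 * exp (- real n / 2)))
   \<and>
   (\<exists>C>0. \<forall>(M :: 'w measure) m p n \<sigma> X A E Y Bhat.
      jrrs_setting M m p n \<sigma> X A E Y Bhat \<and> 1 \<le> mat_rank A \<longrightarrow>
        prediction_risk M X A Bhat
          \<le> C * (\<sigma>\<^sup>2 * real (mat_rank A) *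
                (real n + real (card (nonzero_rows A))
                   * ln (exp 1 * (real p / real (card (nonzero_rows A)))))))
   \<and>
   (\<forall>\<delta>. 0 < \<delta> \<and> \<delta> < 1 \<longrightarrow> (\<exists>C>0. \<forall>(M :: 'w measure) m p n \<sigma> X A E Y Bhat.
      jrrs_setting M m p n \<sigma> X A E Y Bhat \<and> 1 \<le> mat_rank A \<and>
      (card (nonzero_rows A) \<le> n \<or> real (card (nonzero_rows A)) \<le> \<delta> * real p) \<longrightarrow>
        prediction_risk M X A Bhat
          \<le> C * (\<sigma>\<^sup>2 * real (mat_rank A) *
                (real n + real (card (nonzero_rows A))
                   * ln (real p / real (card (nonzero_rows A)))))))"
proof (intro conjI allI impI ballI)
  fix M :: "'w measure" and m p n \<sigma> X A E Y Bhat
  assume set: "jrrs_setting M m p n \<sigma> X A E Y Bhat"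
  then have A: "A \<in> carrier_mat p n" unfolding jrrs_setting_def by blast
  show "integrable M (\<lambda>\<omega>. frob_sq (X * A - X * Bhat \<omega>))"
    by (rule integrable_and_risk_bound(1)[OF set A])
  fix B assume B: "B \<in> carrier_mat p n" and r: "1 \<le> mat_rank B"
  have "0 \<le> 768 * real n * \<sigma>\<^sup>2 * exp (- real n / 2)" by simp
  then show "prediction_risk M X A Bhat \<le> 10 * frob_sq (X * A - X * B) + 8 * jrrs_pen 12 \<sigma> B
                + 768 * real n * \<sigma>\<^sup>2 * exp (- real n / 2)"
    using integrable_and_risk_bound(2)[OF set B r] by linarith
next
  show "\<exists>C>0. \<forall>(M :: 'w measure) m p n \<sigma> X A E Y Bhat.
      jrrs_setting M m p n \<sigma> X A E Y Bhat \<and> 1 \<le> mat_rank A \<longrightarrow>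
        prediction_risk M X A Bhat
          \<le> C * (\<sigma>\<^sup>2 * real (mat_rank A) *
                (real n + real (card (nonzero_rows A))
                   * ln (exp 1 * (real p / real (card (nonzero_rows A))))))"
  proof (intro exI[of _ 288] conjI allI impI)
    fix M :: "'w measure" and m p n \<sigma> X A E Y Bhat
    assume *: "jrrs_setting M m p n \<sigma> X A E Y Bhat \<and> 1 \<le> mat_rank A"
    then have A: "A \<in> carrier_mat p n" unfolding jrrs_setting_def by blast
    show "prediction_risk M X A Bhat \<le> 288 * (\<sigma>\<^sup>2 * real (mat_rank A) *
                (real n + real (card (nonzero_rows A))
                   * ln (exp 1 * (real p / real (card (nonzero_rows A))))))"
      using risk_le_pen[of M m p n \<sigma> X A E Y Bhat] * pen_le_general[OF A, of \<sigma>] by linarith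
  qed simp
next
  fix \<delta> :: real assume \<delta>: "0 < \<delta> \<and> \<delta> < 1"
  then have "0 < ln (1 / \<delta>)" by simp
  then have pos: "0 < 96 * (5 + 3 / ln (1 / \<delta>))" by (simp add: add_pos_pos)
  show "\<exists>C>0. \<forall>(M :: 'w measure) m p n \<sigma> X A E Y Bhat.
      jrrs_setting M m p n \<sigma> X A E Y Bhat \<and> 1 \<le> mat_rank A \<and>
      (card (nonzero_rows A) \<le> n \<or> real (card (nonzero_rows A)) \<le> \<delta> * real p) \<longrightarrow>
        prediction_risk M X A Bhat
          \<le> C * (\<sigma>\<^sup>2 * real (mat_rank A) *
                (real n + real (card (nonzero_rows A))
                   * ln (real p / real (card (nonzero_rows A)))))"
  proof (intro exI[of _ "96 * (5 + 3 / ln (1 / \<delta>))"] conjI allI impI pos)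
    fix M :: "'w measure" and m p n \<sigma> X A E Y Bhat
    assume *: "jrrs_setting M m p n \<sigma> X A E Y Bhat \<and> 1 \<le> mat_rank A \<and>
      (card (nonzero_rows A) \<le> n \<or> real (card (nonzero_rows A)) \<le> \<delta> * real p)"
    then have A: "A \<in> carrier_mat p n" unfolding jrrs_setting_def by blast
    have "prediction_risk M X A Bhat \<le> 8 * jrrs_pen 12 \<sigma> A" using risk_le_pen * by blast
    also have "\<dots> \<le> 96 * (5 + 3 / ln (1 / \<delta>)) * (\<sigma>\<^sup>2 * real (mat_rank A) *
                (real n + real (card (nonzero_rows A))
                   * ln (real p / real (card (nonzero_rows A)))))"
      using pen_le_sparse[OF A] \<delta> * by blast
    finally show "prediction_risk M X A Bhat \<le> 96 * (5 + 3 / ln (1 / \<delta>)) * (\<sigma>\<^sup>2 * real (mat_rank A) *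
                (real n + real (card (nonzero_rows A))
                   * ln (real p / real (card (nonzero_rows A)))))" .
  qed
qed

end
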